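(* For all integers $m\ge 5$ and all $k\in\mathbb{N}$ there exist isomorphisms \[H_k(\mathbb{Z}_{4m-4},c_{m})\cong H_k(\mathbb{Z}_{4m},c_{m+1}).\]
   Context: A (Čech) closure space is a pair $(X,c)$ of a set $X$ and a function $c:2^X\to 2^X$ with $c(\varnothing)=\varnothing$, $A\subset c(A)$, and $c(A\cup B)=c(A)\cup c(B)$ for all $A,B\subset X$. Topological spaces are the closure spaces with $c(c(A))=c(A)$ for all $A$, where $c$ is the topological closure. A map $f:(X,c)\to(Y,d)$ is continuous if $f(c(A))\subset d(f(A))$ for all $A\subset X$. $\mathbb{Z}_n=\{0,1,\dots,n-1\}$ with metric $d(i,j)=\min\{|k| : k\equiv i-j \bmod n\}$. For $m\ge 0$, $c_m(i)=\{j\in\mathbb{Z}_n : d(i,j)\le m\}$ and $c_m(A)=\bigcup_{i\in A}c_m(i)$ for $A\subset\mathbb{Z}_n$. Singular homology: let $|\Delta^n|=\{(t_0,\dots,t_n)\in\mathbb{R}^{n+1} : \sum_i t_i=1,\ t_i\ge 0\}=[e_0,\dots,e_n]$ with the Euclidean topology. For a closure space $X$, $C_n(X)$ is the free abelian group on continuous maps $\sigma:|\Delta^n|\to X$ (and $C_n(X)=0$ for $n<0$), $\partial_n(\sigma)=\sum_{i=0}^n(-1)^i\sigma|_{[e_0,\dots,\hat e_i,\dots,e_n]}$, and $H_n(X)=\ker\partial_n/\operatorname{im}\partial_{n+1}$; $H_k(\mathbb{Z}_n,c_m)$ denotes $H_k$ of the closure space $(\mathbb{Z}_n,c_m)$ (not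 relative homology). *)

theory Defs
  imports "HOL-Homology.Homology" "HOL-Number_Theory.Cong"
begin

section \<open>Closure spaces\<close>

text \<open>A closure space is a pair of a carrier \<open>X\<close> and an operator \<open>c\<close>; only the values of \<open>c\<close>
  on subsets of \<open>X\<close> are relevant.\<close>

definition closure_space :: "'a set \<Rightarrow> ('a set \<Rightarrow> 'a set) \<Rightarrow> bool" where
  "closure_space X c \<longleftrightarrow>
     (\<forall>A. A \<subseteq> X \<longrightarrow> c A \<subseteq> X) \<and> c {} = {} \<and> (\<forall>A. A \<subseteq> X \<longrightarrow> A \<subseteq> c A) \<and>
     (\<forall>A B. A \<subseteq> X \<longrightarrow> B \<subseteq> X \<longrightarrow> c (A \<union> B) = c A \<union> c B)"

definition closure_continuous ::
  "'a set \<Rightarrow> ('a set \<Rightarrow> 'a set) \<Rightarrow> 'b set \<Rightarrow> ('b set \<Rightarrow> 'b set) \<Rightarrow> ('a \<Rightarrow> 'b) \<Rightarrow> bool" where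
  "closure_continuous X c Y d f \<longleftrightarrow> f \<in> X \<rightarrow> Y \<and> (\<forall>A. A \<subseteq> X \<longrightarrow> f ` c A \<subseteq> d (f ` A))"

lemma closure_space_topology: "closure_space (topspace T) ((closure_of) T)"
  unfolding closure_space_def
  by (simp add: closure_of_subset closure_of_subset_topspace closure_of_Un)

lemma closure_continuous_topology:
  "closure_continuous (topspace S) ((closure_of) S) (topspace T) ((closure_of) T) f
     \<longleftrightarrow> continuous_map S T f"
proof
  assume f: "continuous_map S T f"
  have "f \<in> topspace S \<rightarrow> topspace T"
    using f by (rule continuous_map_funspace)
  moreover have "f ` (S closure_of A) \<subseteq> T closure_of (f ` A)" for A
    using f by (rule continuous_map_image_closure_subset)
  ultimately show "closure_continuous (topspace S) ((closure_of) S) (topspace T) ((closure_of) T) f"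
    unfolding closure_continuous_def by (intro conjI allI impI)
next
  assume "closure_continuous (topspace S) ((closure_of) S) (topspace T) ((closure_of) T) f"
  then show "continuous_map S T f"
    unfolding closure_continuous_def continuous_map_eq_image_closure_subset_alt
      image_subset_iff_funcset
    by (elim conjE)
qed

section \<open>Singular homology of closure spaces\<close>

text \<open>As in the library, the standard \<open>n\<close>-simplex consists of real sequences that vanish beyond
  index \<open>n\<close>; the product topology induces the Euclidean topology on it. Singular simplices are
  extensional, so that they correspond exactly to maps defined on the simplex.
  The library's chain boundary does not depend on the topology of the target and is reused.\<close>

abbreviation simplex_topology :: "nat \<Rightarrow> (nat \<Rightarrow> real) topology" where
  "simplex_topology n \<equiv> subtopology (powertop_real UNIV) (standard_simplex n)"

definition closure_singular_simplices ::
  "nat \<Rightarrow> 'a set \<Rightarrow> ('a set \<Rightarrow> 'a set) \<Rightarrow> ((nat \<Rightarrow> real) \<Rightarrow> 'a) set" where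
  "closure_singular_simplices n X c =
     {\<sigma>. closure_continuous (standard_simplex n) ((closure_of) (simplex_topology n)) X c \<sigma> \<and>
         \<sigma> \<in> extensional (standard_simplex n)}"

definition closure_chain_group ::
  "nat \<Rightarrow> 'a set \<Rightarrow> ('a set \<Rightarrow> 'a set) \<Rightarrow> 'a chain monoid" where
  "closure_chain_group n X c = free_Abelian_group (closure_singular_simplices n X c)"

definition closure_cycles :: "nat \<Rightarrow> 'a set \<Rightarrow> ('a set \<Rightarrow> 'a set) \<Rightarrow> 'a chain set" where
  "closure_cycles n X c = {z \<in> carrier (closure_chain_group n X c). chain_boundary n z = 0}"

definition closure_boundaries :: "nat \<Rightarrow> 'a set \<Rightarrow> ('a set \<Rightarrow> 'a set) \<Rightarrow> 'a chain set" where
  "closure_boundaries n X c = chain_boundary (Suc n) ` carrier (closure_chain_group (Suc n) X c)"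

definition closure_homology_group ::
  "nat \<Rightarrow> 'a set \<Rightarrow> ('a set \<Rightarrow> 'a set) \<Rightarrow> 'a chain set monoid" where
  "closure_homology_group n X c =
     (closure_chain_group n X c)\<lparr>carrier := closure_cycles n X c\<rparr> Mod closure_boundaries n X c"

lemma closure_chain_group_topology:
  "closure_chain_group n (topspace T) ((closure_of) T) = chain_group n T"
proof -
  have "closure_singular_simplices n (topspace T) ((closure_of) T) = singular_simplex_set n T"
    using closure_continuous_topology[of "simplex_topology n" T]
    unfolding closure_singular_simplices_def singular_simplex_def topspace_standard_simplex
    by (simp only:)
  then show ?thesis
    by (simp add: closure_chain_group_def chain_group_def)
qed

text \<open>On topological spaces this is the library's singular homology.\<close>

lemma closure_homology_group_topology:
  "closure_homology_group n (topspace T) ((closure_of) T) = homology_group (int n) T"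
proof -
  have cyc: "closure_cycles n (topspace T) ((closure_of) T) = singular_relcycle_set n T {}"
    by (auto simp: closure_cycles_def closure_chain_group_topology singular_cycle)
  have bdy: "closure_boundaries n (topspace T) ((closure_of) T) = singular_relboundary_set n T {}"
    by (auto simp: closure_boundaries_def closure_chain_group_topology singular_boundary)
  have eq: "(chain_group n T)\<lparr>carrier := singular_relcycle_set n T {}\<rparr> = relcycle_group n T {}"
    using carrier_relcycle_group[of n T "{}"]
    by (simp add: relcycle_group_def subgroup_generated_def)
  show ?thesis
    unfolding closure_homology_group_def nontrivial_relative_homology_group cyc bdy
      closure_chain_group_topology eq
    by (rule refl)
qed

section \<open>The closure spaces on the cyclic sets\<close>

definition cyclic_set :: "nat \<Rightarrow> int set" where
  "cyclic_set n = {0..<int n}"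

definition cyclic_dist :: "nat \<Rightarrow> int \<Rightarrow> int \<Rightarrow> int" where
  "cyclic_dist n i j = (LEAST r. \<exists>k. [k = i - j] (mod int n) \<and> r = \<bar>k\<bar>)"

definition cyclic_closure :: "nat \<Rightarrow> nat \<Rightarrow> int set \<Rightarrow> int set" where
  "cyclic_closure n m A = (\<Union>i\<in>A. {j \<in> cyclic_set n. cyclic_dist n i j \<le> int m})"

text \<open>A least element exists although integers are not well-ordered, since the
  candidates are nonnegative.\<close>

lemma cyclic_dist_is_minimum:
  "(\<exists>k. [k = i - j] (mod int n) \<and> cyclic_dist n i j = \<bar>k\<bar>) \<and>
   (\<forall>k. [k = i - j] (mod int n) \<longrightarrow> cyclic_dist n i j \<le> \<bar>k\<bar>)"
proof -
  define P where "P k \<longleftrightarrow> [k = i - j] (mod int n)" for k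
  have "P (i - j)" by (simp add: P_def)
  then obtain k where k: "P k" "\<And>l. P l \<Longrightarrow> nat \<bar>k\<bar> \<le> nat \<bar>l\<bar>"
    using ex_has_least_nat[of P "i - j" "\<lambda>k. nat \<bar>k\<bar>"] by blast
  have min: "\<bar>k\<bar> \<le> \<bar>l\<bar>" if "P l" for l
    using k(2)[OF that] by simp
  have "cyclic_dist n i j = \<bar>k\<bar>"
    unfolding cyclic_dist_def P_def[symmetric]
    by (rule Least_equality) (use k(1) min in auto)
  then show ?thesis
    unfolding P_def[symmetric] using k(1) min by metis
qed

lemma closure_space_cyclic: "closure_space (cyclic_set n) (cyclic_closure n m)"
proof -
  have "cyclic_dist n i i \<le> 0" for i
    using cyclic_dist_is_minimum[of i i n, THEN conjunct2, rule_format, of 0] by simp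
  then have "cyclic_dist n i i \<le> int m" for i
    by (meson of_nat_0_le_iff order_trans)
  then show ?thesis
    unfolding closure_space_def cyclic_closure_def by auto
qed

end

theory Submission
  imports Defs
begin

text \<open>
  Both closure spaces are of the form \<open>(\<int>\<^sub>n, c\<^sub>m)\<close> with \<open>m \<ge> 1\<close> and \<open>n > 3 * m\<close>; for
  \<open>n = 4 * m - 4\<close> this is exactly the hypothesis \<open>m \<ge> 5\<close>. Every such space has the homology of a
  circle (\<open>homology_cyclic_closure_space\<close>), so the two have isomorphic homology in each degree.

  The homology is computed from the covering of \<open>\<int>\<^sub>n\<close> by the line \<open>\<int>\<close>, where the closure of a point
  consists of the integers at distance at most \<open>m\<close>. Since three steps of length at most \<open>m\<close> never
  add up to a nonzero multiple of \<open>n\<close>, continuous maps to \<open>\<int>\<^sub>n\<close> lift locally to the line; on a simplex,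
  which is compact and convex, the local lifts can be glued (\<open>has_step_lift_standard_simplex\<close>), and the lift is
  unique up to translation by multiples of \<open>n\<close> (\<open>step_continuous_lift_unique\<close>).

  The line is contractible: clamping to shrinking intervals around \<open>0\<close> deforms it to the point \<open>0\<close>.
  The resulting cone operator on singular simplices shows that its chain complex \<open>C\<close>
  is acyclic (\<open>step_cycle_imp_boundary\<close>).

  Let \<open>D\<close> be the chain complex of \<open>\<int>\<^sub>n\<close> and let \<open>T\<close> be the translation by \<open>n\<close> on \<open>C\<close>. Lifting
  gives a short exact sequence \<open>0 \<rightarrow> C \<rightarrow> C \<rightarrow> D \<rightarrow> 0\<close> whose first map is \<open>1 - T\<close>
  (\<open>deck_fixed_imp_0\<close>, \<open>lift_proj_coboundary\<close>, \<open>proj_lift_chain\<close>). Its connecting homomorphism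
  is used by hand: for a cycle \<open>z\<close> of \<open>D\<close>, the boundary of a lift of \<open>z\<close> is \<open>(1 - T) b\<close>,
  and \<open>z\<close> bounds as soon as \<open>b\<close> does (\<open>cycle_is_boundary\<close>). In degrees above \<open>1\<close> this is always
  so; in degree \<open>1\<close> the obstruction is the augmentation of \<open>b\<close>, which up to sign is the winding
  number of \<open>z\<close> (\<open>winding_cycle\<close>).
\<close>

section \<open>Integer-valued maps with bounded steps and their lifts\<close>

text \<open>Continuity of a map into the closure space on the integers in which the closure of a point \<open>z\<close>
  is the interval from \<open>z - m\<close> to \<open>z + m\<close>. The values near \<open>x\<close> are compared with the value at
  \<open>x\<close> only; two of them may differ by \<open>2 * m\<close>.\<close>

definition step_continuous_on :: "nat \<Rightarrow> 'a::topological_space set \<Rightarrow> ('a \<Rightarrow> int) \<Rightarrow> bool" where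
  "step_continuous_on m S F \<longleftrightarrow>
     (\<forall>x\<in>S. \<forall>\<^sub>F y in at x within S. \<bar>F y - F x\<bar> \<le> int m)"

text \<open>The same condition modulo \<open>n\<close>: continuity of a map into the closure space on \<open>\<int>/n\<int>\<close> in which
  the closure of a residue class consists of the classes at distance at most \<open>m\<close>.\<close>

definition cyclic_continuous_on ::
  "nat \<Rightarrow> nat \<Rightarrow> 'a::topological_space set \<Rightarrow> ('a \<Rightarrow> int) \<Rightarrow> bool" where
  "cyclic_continuous_on n m S f \<longleftrightarrow>
     (\<forall>x\<in>S. \<forall>\<^sub>F y in at x within S. \<exists>k. \<bar>k\<bar> \<le> int m \<and> int n dvd f y - f x - k)"

lemma eventually_at_within_subset:
  "eventually P (at x within S) \<Longrightarrow> R \<subseteq> S \<Longrightarrow> eventually P (at x within R)"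
  using at_le filter_leD by blast

lemma step_continuous_on_subset:
  "step_continuous_on m S F \<Longrightarrow> R \<subseteq> S \<Longrightarrow> step_continuous_on m R F"
  unfolding step_continuous_on_def by (blast intro: eventually_at_within_subset)

lemma step_continuous_on_cong:
  assumes "\<And>x. x \<in> S \<Longrightarrow> F x = G x" "step_continuous_on m S F"
  shows "step_continuous_on m S G"
  unfolding step_continuous_on_def
proof
  fix x assume x: "x \<in> S"
  then have "\<forall>\<^sub>F y in at x within S. \<bar>F y - F x\<bar> \<le> int m"
    using assms(2) by (simp add: step_continuous_on_def)
  then show "\<forall>\<^sub>F y in at x within S. \<bar>G y - G x\<bar> \<le> int m"
    unfolding eventually_at_filter by eventually_elim (use assms(1) x in auto)
qed

lemma step_continuous_on_shift:
  "step_continuous_on m S (\<lambda>x. F x + c) \<longleftrightarrow> step_continuous_on m S F"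
  by (simp add: step_continuous_on_def)

lemma step_continuous_on_compose:
  assumes F: "step_continuous_on m S F" and g: "continuous_on R g" "g ` R \<subseteq> S"
  shows "step_continuous_on m R (F \<circ> g)"
  unfolding step_continuous_on_def
proof
  fix x assume x: "x \<in> R"
  have "\<forall>\<^sub>F y in nhds (g x). y \<in> S \<longrightarrow> \<bar>F y - F (g x)\<bar> \<le> int m"
  proof -
    have "\<forall>\<^sub>F y in at (g x) within S. \<bar>F y - F (g x)\<bar> \<le> int m"
      using F x g by (auto simp: step_continuous_on_def)
    then show ?thesis
      unfolding eventually_at_filter by eventually_elim auto
  qed
  moreover have "(g \<longlongrightarrow> g x) (at x within R)"
    using g x by (auto simp: continuous_on_def)
  ultimately have "\<forall>\<^sub>F y in at x within R. g y \<in> S \<longrightarrow> \<bar>F (g y) - F (g x)\<bar> \<le> int m"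
    unfolding filterlim_iff by blast
  then show "\<forall>\<^sub>F y in at x within R. \<bar>(F \<circ> g) y - (F \<circ> g) x\<bar> \<le> int m"
    unfolding eventually_at_filter by eventually_elim (use g in auto)
qed

lemma multiple_abs_less_imp_zero:
  "int n dvd a \<Longrightarrow> \<bar>a\<bar> < int n \<Longrightarrow> a = 0"
  using dvd_imp_le_int[of a "int n"] by auto

text \<open>The difference of two lifts is a multiple of \<open>n\<close> that changes by at most \<open>2 * m\<close> close to a
  point, so it is locally constant.\<close>

lemma step_continuous_lift_unique:
  assumes "connected S" "2 * m < n"
    and F: "step_continuous_on m S F" and G: "step_continuous_on m S G"
    and dvd: "\<And>x. x \<in> S \<Longrightarrow> int n dvd G x - F x"
  shows "\<exists>j. \<forall>x\<in>S. G x = F x + j * int n"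
proof (cases "S = {}")
  case False
  then obtain a where a: "a \<in> S" by auto
  have loc: "\<forall>x\<in>S. \<forall>\<^sub>F y in at x within S. G x - F x = G y - F y"
  proof
    fix x assume x: "x \<in> S"
    then have "\<forall>\<^sub>F y in at x within S. \<bar>F y - F x\<bar> \<le> int m" "\<forall>\<^sub>F y in at x within S. \<bar>G y - G x\<bar> \<le> int m"
      using F G by (auto simp: step_continuous_on_def)
    then show "\<forall>\<^sub>F y in at x within S. G x - F x = G y - F y"
      unfolding eventually_at_filter
    proof eventually_elim
      case (elim y)
      show ?case
      proof (intro impI)
        assume y: "y \<noteq> x" "y \<in> S"
        have "int n dvd (G y - F y) - (G x - F x)"
          using dvd_diff[OF dvd dvd] x y by blast
        moreover have "\<bar>(G y - F y) - (G x - F x)\<bar> < int n"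
          using elim y assms(2) by auto
        ultimately have "(G y - F y) - (G x - F x) = 0"
          by (rule multiple_abs_less_imp_zero)
        then show "G x - F x = G y - F y" by simp
      qed
    qed
  qed
  obtain j where j: "G a - F a = j * int n"
    using dvd[OF a] by (auto simp: dvd_def mult.commute)
  have "G x - F x = G a - F a" if "x \<in> S" for x
    using connected_local_const[OF assms(1) that a, of "\<lambda>x. G x - F x"] loc by blast
  then have "\<forall>x\<in>S. G x = F x + j * int n"
    using j by (metis add.commute diff_add_cancel)
  then show ?thesis ..
qed auto

definition has_step_lift ::
  "nat \<Rightarrow> nat \<Rightarrow> ('a::topological_space \<Rightarrow> int) \<Rightarrow> 'a set \<Rightarrow> bool" where
  "has_step_lift n m f S \<longleftrightarrow>
     (\<exists>F. step_continuous_on m S F \<and> (\<forall>x\<in>S. int n dvd F x - f x))"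

lemma has_step_lift_subset:
  "has_step_lift n m f S \<Longrightarrow> R \<subseteq> S \<Longrightarrow> has_step_lift n m f R"
  unfolding has_step_lift_def by (meson step_continuous_on_subset subsetD)

text \<open>Near \<open>x\<close> every value is a step of size at most \<open>m\<close> away from \<open>f x\<close>, and adding that step to
  \<open>f x\<close> is a lift. That this lift is step-continuous at the other points near \<open>x\<close>, too, is where
  \<open>3 * m < n\<close> enters: a triangle of pairwise close residue classes does not wind around the circle.\<close>

lemma has_step_lift_locally:
  assumes f: "cyclic_continuous_on n m S f" and nm: "3 * m < n" and x: "x \<in> S"
  obtains U where "open U" "x \<in> U" "has_step_lift n m f (S \<inter> U)"
proof -
  have "\<forall>\<^sub>F y in at x within S. \<exists>k. \<bar>k\<bar> \<le> int m \<and> int n dvd f y - f x - k"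
    using f x by (auto simp: cyclic_continuous_on_def)
  then obtain U where U: "open U" "x \<in> U"
    and "\<And>y. y \<in> U \<Longrightarrow> y \<noteq> x \<Longrightarrow> y \<in> S \<Longrightarrow> \<exists>k. \<bar>k\<bar> \<le> int m \<and> int n dvd f y - f x - k"
    unfolding eventually_at_topological by metis
  then have "\<forall>y\<in>S \<inter> U. \<exists>k. \<bar>k\<bar> \<le> int m \<and> int n dvd f y - f x - k"
    by (metis IntD1 IntD2 abs_zero cancel_comm_monoid_add_class.diff_cancel dvd_0_right of_nat_0_le_iff)
  then obtain k where k: "\<And>y. y \<in> S \<inter> U \<Longrightarrow> \<bar>k y\<bar> \<le> int m \<and> int n dvd f y - f x - k y"
    by (metis (no_types))
  have "step_continuous_on m (S \<inter> U) (\<lambda>y. f x + k y)"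
    unfolding step_continuous_on_def
  proof
    fix y assume y: "y \<in> S \<inter> U"
    then have "\<forall>\<^sub>F z in at y within S. \<exists>k. \<bar>k\<bar> \<le> int m \<and> int n dvd f z - f y - k"
      using f by (auto simp: cyclic_continuous_on_def)
    then show "\<forall>\<^sub>F z in at y within S \<inter> U. \<bar>(f x + k z) - (f x + k y)\<bar> \<le> int m"
      unfolding eventually_at_filter
    proof eventually_elim
      case (elim z)
      show ?case
      proof (intro impI)
        assume z: "z \<noteq> y" "z \<in> S \<inter> U"
        then obtain l where l: "\<bar>l\<bar> \<le> int m" "int n dvd f z - f y - l"
          using elim by auto
        \<comment> \<open>Three steps of size at most \<open>m\<close> around the triangle on the values at \<open>x\<close>, \<open>y\<close>, \<open>z\<close>
          are too short to wind around the circle.\<close>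
        have "int n dvd (f z - f y - l) - (f z - f x - k z) + (f y - f x - k y)"
          using dvd_add[OF dvd_diff] l k[OF y] k[OF z(2)] by blast
        then have "int n dvd k z - k y - l"
          by (simp add: algebra_simps)
        moreover have "\<bar>k z - k y - l\<bar> < int n"
          using l k[OF y] k[OF z(2)] nm by linarith
        ultimately have "k z - k y - l = 0"
          by (rule multiple_abs_less_imp_zero)
        then show "\<bar>(f x + k z) - (f x + k y)\<bar> \<le> int m"
          using l by simp
      qed
    qed
  qed
  moreover have "int n dvd f x + k y - f y" if "y \<in> S \<inter> U" for y
  proof -
    have "f x + k y - f y = - (f y - f x - k y)" by simp
    then show ?thesis using k[OF that] by (simp only: dvd_minus_iff)
  qed
  ultimately have "has_step_lift n m f (S \<inter> U)"
    unfolding has_step_lift_def by blast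
  then show ?thesis using U that by blast
qed

lemma eventually_at_within_closed_notin:
  "closed A \<Longrightarrow> x \<notin> A \<Longrightarrow> eventually P (at x within A)"
  unfolding eventually_at_topological by (rule exI[of _ "- A"]) auto

text \<open>On the connected intersection the two lifts differ by a constant multiple of \<open>n\<close>, so one of
  them can be translated to agree with the other. Closedness of both pieces makes the union of the
  two lifts step-continuous: near a point outside a piece, that piece is not seen.\<close>

lemma has_step_lift_glue:
  assumes A: "closed A" "has_step_lift n m f A" and B: "closed B" "has_step_lift n m f B"
    and con: "connected (A \<inter> B)" and nm: "2 * m < n"
  shows "has_step_lift n m f (A \<union> B)"
proof -
  obtain F G where F: "step_continuous_on m A F" "\<And>x. x \<in> A \<Longrightarrow> int n dvd F x - f x"
    and G: "step_continuous_on m B G" "\<And>x. x \<in> B \<Longrightarrow> int n dvd G x - f x"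
    using A B unfolding has_step_lift_def by blast
  have "\<exists>j. \<forall>x\<in>A \<inter> B. F x = G x + j * int n"
  proof (rule step_continuous_lift_unique[OF con nm])
    show "int n dvd F x - G x" if "x \<in> A \<inter> B" for x
      using dvd_diff[OF F(2) G(2), of x x] that by simp
  qed (use F G step_continuous_on_subset in blast)+
  then obtain j where j: "\<And>x. x \<in> A \<inter> B \<Longrightarrow> F x = G x + j * int n" by blast
  define H where "H x = (if x \<in> A then F x else G x + j * int n)" for x
  have HB: "H x = G x + j * int n" if "x \<in> B" for x
    using j that by (auto simp: H_def)
  have HA: "step_continuous_on m A H"
    by (rule step_continuous_on_cong[OF _ F(1)]) (auto simp: H_def)
  have "step_continuous_on m B (\<lambda>x. G x + j * int n)"
    using G(1) by (simp add: step_continuous_on_shift)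
  then have HB': "step_continuous_on m B H"
    by (rule step_continuous_on_cong[rotated]) (auto simp: HB)
  have "step_continuous_on m (A \<union> B) H"
    unfolding step_continuous_on_def
  proof
    fix x assume "x \<in> A \<union> B"
    have "\<forall>\<^sub>F y in at x within A. \<bar>H y - H x\<bar> \<le> int m"
      using HA A(1) eventually_at_within_closed_notin
      by (cases "x \<in> A") (auto simp: step_continuous_on_def)
    moreover have "\<forall>\<^sub>F y in at x within B. \<bar>H y - H x\<bar> \<le> int m"
      using HB' B(1) eventually_at_within_closed_notin
      by (cases "x \<in> B") (auto simp: step_continuous_on_def)
    ultimately show "\<forall>\<^sub>F y in at x within A \<union> B. \<bar>H y - H x\<bar> \<le> int m"
      by (simp add: at_within_union eventually_sup)
  qed
  moreover have "int n dvd H x - f x" if "x \<in> A \<union> B" for x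
  proof (cases "x \<in> A")
    case False
    then have "int n dvd (G x - f x) + j * int n"
      using that G(2) by (intro dvd_add) auto
    then show ?thesis using False by (simp add: H_def algebra_simps)
  qed (use F(2) in \<open>simp add: H_def\<close>)
  ultimately show ?thesis
    unfolding has_step_lift_def by blast
qed

section \<open>Lifting over a simplex\<close>

text \<open>Convexity, written out in coordinates.\<close>

definition segment_closed :: "(nat \<Rightarrow> real) set \<Rightarrow> bool" where
  "segment_closed S \<longleftrightarrow>
     (\<forall>x\<in>S. \<forall>y\<in>S. \<forall>u\<in>{0..1}. (\<lambda>i. (1 - u) * x i + u * y i) \<in> S)"

lemma segment_closed_imp_connected:
  assumes "segment_closed S" shows "connected S"
proof (rule path_connected_imp_connected)
  show "path_connected S"
    unfolding path_connected_def
  proof (intro ballI)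
    fix x y assume xy: "x \<in> S" "y \<in> S"
    let ?g = "\<lambda>u::real. \<lambda>i. (1 - u) * x i + u * y i"
    have "path ?g"
      unfolding path_def
      by (intro continuous_on_coordinatewise_then_product continuous_intros)
    moreover have "path_image ?g \<subseteq> S"
      using assms xy by (auto simp: path_image_def segment_closed_def)
    ultimately show "\<exists>g. path g \<and> path_image g \<subseteq> S \<and> pathstart g = x \<and> pathfinish g = y"
      by (intro exI[of _ ?g]) (auto simp: pathstart_def pathfinish_def)
  qed
qed

lemma segment_closed_standard_simplex: "segment_closed (standard_simplex p)"
  by (simp add: segment_closed_def convex_standard_simplex)

lemma segment_closed_Int:
  "segment_closed S \<Longrightarrow> segment_closed R \<Longrightarrow> segment_closed (S \<inter> R)"
  by (simp add: segment_closed_def)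

lemma segment_closed_coordinate_slab: "segment_closed {x. c \<le> x k \<and> x k \<le> d}"
proof -
  have "c \<le> (1 - u) * s + u * t \<and> (1 - u) * s + u * t \<le> d"
    if "c \<le> s" "s \<le> d" "c \<le> t" "t \<le> d" "0 \<le> u" "u \<le> 1" for s t u :: real
    using that convexD_alt[OF convex_real_interval(5)[of c d], of s t u] by (auto simp: algebra_simps)
  then show ?thesis by (simp add: segment_closed_def)
qed

lemma closed_coordinate_slab: "closed {x::nat \<Rightarrow> real. c \<le> x k \<and> x k \<le> d}"
  by (intro closed_Collect_conj closed_Collect_le continuous_intros) auto

lemma closed_standard_simplex: "closed (standard_simplex p)"
  using closedin_standard_simplex[of p] by (simp add: euclidean_product_topology)

text \<open>Only the first \<open>k\<close> coordinates are restricted, so that \<open>k = 0\<close> gives the whole space and, inside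
  the \<open>p\<close>-simplex, \<open>k = Suc p\<close> gives the small neighbourhoods of a point.\<close>

definition coordinate_box :: "nat \<Rightarrow> (nat \<Rightarrow> real) \<Rightarrow> real \<Rightarrow> (nat \<Rightarrow> real) set" where
  "coordinate_box k a \<epsilon> = {x. \<forall>j<k. a j - \<epsilon> \<le> x j \<and> x j \<le> a j + \<epsilon>}"

lemma coordinate_box_eq:
  "coordinate_box k a \<epsilon> = (\<Inter>j<k. {x. a j - \<epsilon> \<le> x j \<and> x j \<le> a j + \<epsilon>})"
  by (auto simp: coordinate_box_def)

lemma closed_coordinate_box: "closed (coordinate_box k a \<epsilon>)"
  unfolding coordinate_box_eq by (intro closed_INT ballI closed_coordinate_slab)

lemma segment_closed_coordinate_box: "segment_closed (coordinate_box k a \<epsilon>)"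
  unfolding coordinate_box_eq
proof -
  have "segment_closed (\<Inter>j\<in>J. S j)" if "\<And>j. segment_closed (S j)" for J :: "nat set" and S
    using that by (auto simp: segment_closed_def)
  then show "segment_closed (\<Inter>j<k. {x. a j - \<epsilon> \<le> x j \<and> x j \<le> a j + \<epsilon>})"
    using segment_closed_coordinate_slab by simp
qed

lemma coordinate_box_mono:
  "\<epsilon> \<le> \<delta> \<Longrightarrow> coordinate_box k a \<epsilon> \<subseteq> coordinate_box k a \<delta>"
  by (force simp: coordinate_box_def)

lemma coordinate_box_in_open:
  assumes "open U" "a \<in> U" "\<And>j. j \<ge> k \<Longrightarrow> a j = 0"
  obtains \<epsilon> where "\<epsilon> > 0" "coordinate_box k a \<epsilon> \<inter> {x. \<forall>j\<ge>k. x j = 0} \<subseteq> U"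
proof -
  obtain V where V: "a \<in> Pi\<^sub>E UNIV V" "\<And>i. open (V i)" "Pi\<^sub>E UNIV V \<subseteq> U"
    using product_topology_open_contains_basis[of "\<lambda>_. euclidean" UNIV U a] assms
    by (auto simp: euclidean_product_topology)
  have "\<exists>\<epsilon>>0. \<forall>t. \<bar>t - a j\<bar> \<le> \<epsilon> \<longrightarrow> t \<in> V j" for j
  proof -
    have "open (V j)" "a j \<in> V j" using V by auto
    then obtain e where "e > 0" "cball (a j) e \<subseteq> V j"
      using open_contains_cball by blast
    then show ?thesis by (auto simp: subset_iff dist_real_def abs_minus_commute)
  qed
  then obtain e where e: "\<And>j. e j > 0" "\<And>j t. \<bar>t - a j\<bar> \<le> e j \<Longrightarrow> t \<in> V j" by metis
  define \<epsilon> where "\<epsilon> = Min (insert 1 (e ` {..<k}))"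
  have \<epsilon>: "\<epsilon> > 0" "\<And>j. j < k \<Longrightarrow> \<epsilon> \<le> e j"
    using e(1) by (auto simp: \<epsilon>_def)
  have "x \<in> U" if x: "x \<in> coordinate_box k a \<epsilon>" "\<forall>j\<ge>k. x j = 0" for x
  proof -
    have "x j \<in> V j" for j
    proof (cases "j < k")
      case True
      then have "a j - \<epsilon> \<le> x j \<and> x j \<le> a j + \<epsilon>"
        using x(1) by (simp add: coordinate_box_def)
      then have "\<bar>x j - a j\<bar> \<le> e j"
        using \<epsilon>(2)[OF True] by linarith
      then show ?thesis by (rule e(2))
    next
      case False
      then have "x j = a j" using x(2) assms(3) by simp
      then show ?thesis using V(1) by auto
    qed
    then show ?thesis using V(3) by auto
  qed
  then show ?thesis using that[OF \<epsilon>(1)] by auto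
qed

text \<open>Starting from the local lifts at \<open>k = Suc p\<close>, the coordinates are released one after the other.
  To release coordinate \<open>k\<close>, the interval from \<open>0\<close> to \<open>1\<close> in which it varies is cut into short
  pieces (Bolzano's principle), and the lifts over two adjacent slabs are glued along the slab of
  width \<open>0\<close> between them, which is convex and hence connected.\<close>

lemma has_step_lift_coordinate_box:
  assumes f: "cyclic_continuous_on n m (standard_simplex p) f" and nm: "3 * m < n"
  assumes "k \<le> Suc p"
  shows "\<exists>\<epsilon>>0. has_step_lift n m f (standard_simplex p \<inter> coordinate_box k a \<epsilon>)"
  using \<open>k \<le> Suc p\<close>
proof (induction k arbitrary: a rule: inc_induct)
  case base
  let ?a = "\<lambda>i. if i \<le> p then a i else 0"
  have box: "coordinate_box (Suc p) ?a = coordinate_box (Suc p) a"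
    by (auto simp: coordinate_box_def fun_eq_iff less_Suc_eq_le)
  have zero: "standard_simplex p \<subseteq> {x. \<forall>j\<ge>Suc p. x j = 0}"
    by (auto simp: standard_simplex_def)
  \<comment> \<open>If \<open>?a\<close> is not a point of the simplex, there is nothing to lift close to it.\<close>
  obtain U where U: "open U" "?a \<in> U" "has_step_lift n m f (standard_simplex p \<inter> U)"
  proof (cases "?a \<in> standard_simplex p")
    case True
    then show ?thesis using has_step_lift_locally[OF f nm] that by blast
  next
    case False
    have "has_step_lift n m f (standard_simplex p \<inter> - standard_simplex p)"
      by (simp add: has_step_lift_def step_continuous_on_def)
    then show ?thesis
      using that[of "- standard_simplex p"] False closed_standard_simplex by blast
  qed
  obtain \<epsilon> where "\<epsilon> > 0" "coordinate_box (Suc p) ?a \<epsilon> \<inter> {x. \<forall>j\<ge>Suc p. x j = 0} \<subseteq> U"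
    using coordinate_box_in_open[OF U(1,2), of "Suc p"] by auto
  then show ?case
    using zero box U(3) by (intro exI[of _ \<epsilon>]) (auto elim!: has_step_lift_subset)
next
  case (step k)
  define P where "P c d \<longleftrightarrow> (\<exists>\<epsilon>>0. has_step_lift n m f
      (standard_simplex p \<inter> coordinate_box k a \<epsilon> \<inter> {x. c \<le> x k \<and> x k \<le> d}))" for c d
  have "P 0 1"
  proof (rule Bolzano)
    fix b c d assume P: "P b c" "P c d" and bcd: "b \<le> c" "c \<le> d"
    obtain \<epsilon> \<delta> where \<epsilon>: "\<epsilon> > 0"
      "has_step_lift n m f (standard_simplex p \<inter> coordinate_box k a \<epsilon> \<inter> {x. b \<le> x k \<and> x k \<le> c})"
      and \<delta>: "\<delta> > 0"
      "has_step_lift n m f (standard_simplex p \<inter> coordinate_box k a \<delta> \<inter> {x. c \<le> x k \<and> x k \<le> d})"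
      using P unfolding P_def by blast
    define \<eta> where "\<eta> = min \<epsilon> \<delta>"
    define S where "S = standard_simplex p \<inter> coordinate_box k a \<eta>"
    have S: "closed S" "segment_closed S"
      by (auto simp: S_def closed_standard_simplex closed_coordinate_box closed_Int
          segment_closed_Int segment_closed_standard_simplex segment_closed_coordinate_box)
    have "has_step_lift n m f (S \<inter> {x. b \<le> x k \<and> x k \<le> c} \<union> S \<inter> {x. c \<le> x k \<and> x k \<le> d})"
    proof (rule has_step_lift_glue)
      have "S \<inter> {x. b \<le> x k \<and> x k \<le> c} \<inter> (S \<inter> {x. c \<le> x k \<and> x k \<le> d}) =
            S \<inter> {x. c \<le> x k \<and> x k \<le> c}"
        using bcd by auto
      then show "connected (S \<inter> {x. b \<le> x k \<and> x k \<le> c} \<inter> (S \<inter> {x. c \<le> x k \<and> x k \<le> d}))"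
        using S segment_closed_imp_connected segment_closed_Int segment_closed_coordinate_slab
        by metis
      show "has_step_lift n m f (S \<inter> {x. b \<le> x k \<and> x k \<le> c})"
        using \<epsilon>(2) coordinate_box_mono[of \<eta> \<epsilon> k a]
        by (rule_tac has_step_lift_subset) (auto simp: S_def \<eta>_def)
      show "has_step_lift n m f (S \<inter> {x. c \<le> x k \<and> x k \<le> d})"
        using \<delta>(2) coordinate_box_mono[of \<eta> \<delta> k a]
        by (rule_tac has_step_lift_subset) (auto simp: S_def \<eta>_def)
    qed (use nm S closed_coordinate_slab in auto)
    also have "S \<inter> {x. b \<le> x k \<and> x k \<le> c} \<union> S \<inter> {x. c \<le> x k \<and> x k \<le> d} =
               S \<inter> {x. b \<le> x k \<and> x k \<le> d}"
      using bcd by auto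
    finally show "P b d"
      unfolding P_def S_def using \<epsilon>(1) \<delta>(1) by (intro exI[of _ \<eta>]) (auto simp: \<eta>_def)
  next
    fix t :: real
    obtain \<epsilon> where \<epsilon>: "\<epsilon> > 0"
      "has_step_lift n m f (standard_simplex p \<inter> coordinate_box (Suc k) (a(k := t)) \<epsilon>)"
      using step.IH by blast
    show "\<exists>\<delta>>0. \<forall>c d. c \<le> t \<and> t \<le> d \<and> d - c < \<delta> \<longrightarrow> P c d"
    proof (intro exI[of _ \<epsilon>] conjI allI impI \<epsilon>(1))
      fix c d assume cd: "c \<le> t \<and> t \<le> d \<and> d - c < \<epsilon>"
      have "coordinate_box k a \<epsilon> \<inter> {x. c \<le> x k \<and> x k \<le> d} \<subseteq> coordinate_box (Suc k) (a(k := t)) \<epsilon>"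
        using cd by (auto simp: coordinate_box_def less_Suc_eq)
      then show "P c d"
        unfolding P_def using \<epsilon> by (intro exI[of _ \<epsilon>]) (auto elim!: has_step_lift_subset)
    qed
  qed simp
  then obtain \<epsilon> where "\<epsilon> > 0" and
    "has_step_lift n m f (standard_simplex p \<inter> coordinate_box k a \<epsilon> \<inter> {x. 0 \<le> x k \<and> x k \<le> 1})"
    unfolding P_def by blast
  moreover have "standard_simplex p \<inter> coordinate_box k a \<epsilon> \<inter> {x. 0 \<le> x k \<and> x k \<le> 1} =
                 standard_simplex p \<inter> coordinate_box k a \<epsilon>"
    by (auto simp: standard_simplex_def)
  ultimately show ?case by auto
qed

lemma has_step_lift_standard_simplex:
  assumes "cyclic_continuous_on n m (standard_simplex p) f" and "3 * m < n"
  shows "has_step_lift n m f (standard_simplex p)"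
  using has_step_lift_coordinate_box[OF assms, of 0] by (auto simp: coordinate_box_def)

section \<open>The cone operator on chains of the line\<close>

definition step_simplices :: "nat \<Rightarrow> nat \<Rightarrow> ((nat \<Rightarrow> real) \<Rightarrow> int) set" where
  "step_simplices m p =
     {F. step_continuous_on m (standard_simplex p) F \<and> F \<in> extensional (standard_simplex p)}"

text \<open>The nearest point projection onto the interval from \<open>- N\<close> to \<open>N\<close> (for \<open>0 \<le> N\<close>).\<close>

definition clamp :: "int \<Rightarrow> int \<Rightarrow> int" where
  "clamp N x = max (- N) (min N x)"

text \<open>For \<open>x\<close> in a simplex, other than the vertex \<open>0\<close>, this is the point of the opposite face on the
  ray from that vertex through \<open>x\<close>.\<close>

definition cone_base_point :: "(nat \<Rightarrow> real) \<Rightarrow> nat \<Rightarrow> real" where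
  "cone_base_point x = (\<lambda>i. x (Suc i) / (1 - x 0))"

text \<open>The cone over \<open>\<sigma>\<close> with apex value \<open>0\<close>. It comes from the contraction of the line that at time
  \<open>t > 0\<close> clamps to radius \<open>\<lfloor>1 / t\<rfloor> - 1\<close> and is the identity at time \<open>0\<close>: the radius is \<open>0\<close> for
  \<open>1 / 2 < t\<close>, changes by one at a time, and exceeds any bound as \<open>t\<close> tends to \<open>0\<close>. At the apex
  \<open>x 0 = 1\<close> the base point is a default value, but there the radius \<open>0\<close> forces the
  value \<open>0\<close>.\<close>

definition step_cone :: "nat \<Rightarrow> ((nat \<Rightarrow> real) \<Rightarrow> int) \<Rightarrow> (nat \<Rightarrow> real) \<Rightarrow> int" where
  "step_cone p \<sigma> = restrict
     (\<lambda>x. if x 0 = 0 then \<sigma> (cone_base_point x)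
          else clamp (\<lfloor>1 / x 0\<rfloor> - 1) (\<sigma> (cone_base_point x)))
     (standard_simplex (Suc p))"

text \<open>Clamping to radii that differ by at most one does not spoil a step of size at most \<open>m\<close>, since
  the radius can only matter for a point that leaves the smaller interval.\<close>

lemma clamp_step:
  assumes "\<bar>v - u\<bar> \<le> m" "\<bar>M - N\<bar> \<le> 1" "0 \<le> N" "0 \<le> M" "1 \<le> m"
  shows "\<bar>clamp M v - clamp N u\<bar> \<le> m"
  using assms unfolding clamp_def by linarith

lemma clamp_id: "\<bar>x\<bar> \<le> N \<Longrightarrow> clamp N x = x"
  by (auto simp: clamp_def)

lemma floor_inverse_near_one: "1 / 2 < t \<Longrightarrow> t \<le> 1 \<Longrightarrow> \<lfloor>1 / t\<rfloor> = (1::int)" for t :: real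
  by (rule floor_unique) (auto simp: field_simps)

lemma standard_simplex_Suc_bounds:
  assumes "x \<in> standard_simplex (Suc p)"
  shows "0 \<le> x i" "x i \<le> 1" "x (Suc i) \<le> 1 - x 0" "(\<Sum>i\<le>p. x (Suc i)) = 1 - x 0"
proof -
  have x: "\<And>i. 0 \<le> x i \<and> x i \<le> 1" "\<And>i. i > Suc p \<Longrightarrow> x i = 0" "(\<Sum>i\<le>Suc p. x i) = 1"
    using assms by (auto simp: standard_simplex_def)
  show "0 \<le> x i" "x i \<le> 1" using x(1) by auto
  have "(\<Sum>i\<le>Suc p. x i) = x 0 + (\<Sum>i\<le>p. x (Suc i))"
    by (rule sum.atMost_Suc_shift)
  then show s: "(\<Sum>i\<le>p. x (Suc i)) = 1 - x 0" using x(3) by simp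
  show "x (Suc i) \<le> 1 - x 0"
  proof (cases "i \<le> p")
    case True
    then have "x (Suc i) \<le> (\<Sum>i\<le>p. x (Suc i))"
      using x(1) by (intro member_le_sum) auto
    then show ?thesis using s by simp
  next
    case False
    then show ?thesis using x(1)[of 0] x(2)[of "Suc i"] by simp
  qed
qed

lemma cone_base_point_in_simplex:
  assumes x: "x \<in> standard_simplex (Suc p)" and "x 0 < 1"
  shows "cone_base_point x \<in> standard_simplex p"
proof -
  have "(\<Sum>i\<le>p. x (Suc i) / (1 - x 0)) = 1"
    using standard_simplex_Suc_bounds(4)[OF x] assms(2) by (simp flip: sum_divide_distrib)
  moreover have "x (Suc i) = 0" if "i > p" for i
    using x that by (auto simp: standard_simplex_def)
  ultimately show ?thesis
    using standard_simplex_Suc_bounds(1,3)[OF x] assms(2)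
    by (auto simp: standard_simplex_def cone_base_point_def field_simps)
qed

lemma continuous_on_coordinate: "continuous_on S (\<lambda>y::nat \<Rightarrow> real. y i)"
  by (rule continuous_on_subset[OF continuous_on_product_coordinates]) simp

lemma tendsto_coordinate_within:
  "filterlim (\<lambda>y. y i) (nhds (x i)) (at x within S)" for x :: "nat \<Rightarrow> real"
proof -
  have "filterlim (\<lambda>y. y i) (nhds (x i)) (at x within UNIV)"
    by (rule continuous_on_def[THEN iffD1, rule_format, OF continuous_on_coordinate UNIV_I])
  then show ?thesis
    by (rule tendsto_within_subset) simp
qed

text \<open>Three regimes: near the apex the cone is constant; near the base face the clamping radius
  exceeds all values that occur nearby, so the cone agrees with \<open>\<sigma>\<close> composed with the radial
  projection; in between the radius jumps by at most one close to a given point.\<close>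

lemma step_cone_in_step_simplices:
  assumes \<sigma>: "\<sigma> \<in> step_simplices m p" and m: "1 \<le> m"
  shows "step_cone p \<sigma> \<in> step_simplices m (Suc p)"
proof -
  let ?S = "standard_simplex (Suc p)"
  let ?C = "\<lambda>x. if x 0 = 0 then \<sigma> (cone_base_point x)
          else clamp (\<lfloor>1 / x 0\<rfloor> - 1) (\<sigma> (cone_base_point x))"
  have "step_continuous_on m ?S ?C"
    unfolding step_continuous_on_def
  proof
    fix x assume x: "x \<in> ?S"
    have lim: "filterlim (\<lambda>y. y 0) (nhds (x 0)) (at x within ?S)"
      by (rule tendsto_coordinate_within)
    have inS: "\<forall>\<^sub>F y in at x within ?S. y \<in> ?S"
      by (simp add: eventually_at_filter)
    consider "x 0 = 1" | "x 0 < 1"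
      using standard_simplex_Suc_bounds(2)[OF x, of 0] by linarith
    then show "\<forall>\<^sub>F y in at x within ?S. \<bar>?C y - ?C x\<bar> \<le> int m"
    proof cases
      case 1
      then have "\<forall>\<^sub>F y in at x within ?S. 1 / 2 < y 0"
        by (intro order_tendstoD(1)[OF lim]) simp
      then show ?thesis
        using inS
      proof eventually_elim
        case (elim y)
        then have "\<lfloor>1 / y 0\<rfloor> = 1"
          using standard_simplex_Suc_bounds(2) floor_inverse_near_one by blast
        then show ?case using elim 1 by (simp add: clamp_def)
      qed
    next
      case 2
      define u where "u = \<sigma> (cone_base_point x)"
      let ?R = "{y \<in> ?S. y 0 < 1}"
      have "step_continuous_on m ?R (\<sigma> \<circ> cone_base_point)"
      proof (rule step_continuous_on_compose)
        show "step_continuous_on m (standard_simplex p) \<sigma>"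
          using \<sigma> by (simp add: step_simplices_def)
        show "continuous_on ?R cone_base_point"
          unfolding cone_base_point_def
          by (intro continuous_on_coordinatewise_then_product continuous_intros
              continuous_on_coordinate) auto
        show "cone_base_point ` ?R \<subseteq> standard_simplex p"
          using cone_base_point_in_simplex by auto
      qed
      then have near_R: "\<forall>\<^sub>F y in at x within ?R. \<bar>\<sigma> (cone_base_point y) - u\<bar> \<le> int m"
        using x 2 by (auto simp: step_continuous_on_def u_def)
      have "\<forall>\<^sub>F y in at x within ?S. y 0 < 1"
        using order_tendstoD(2)[OF lim 2] .
      then have near: "\<forall>\<^sub>F y in at x within ?S. \<bar>\<sigma> (cone_base_point y) - u\<bar> \<le> int m"
        using near_R unfolding eventually_at_filter by eventually_elim auto
      show ?thesis
      proof (cases "x 0 = 0")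
        case True
        \<comment> \<open>All values close to \<open>x\<close> are at most \<open>\<bar>u\<bar> + m\<close> in absolute value, so clamping to this radius
          or a larger one leaves them alone.\<close>
        have "\<forall>\<^sub>F y in at x within ?S. y 0 < 1 / of_int (\<bar>u\<bar> + int m + 1)"
          by (rule order_tendstoD(2)[OF lim]) (simp add: True)
        then show ?thesis
          using near inS
        proof eventually_elim
          case (elim y)
          let ?v = "\<sigma> (cone_base_point y)"
          show ?case
          proof (cases "y 0 = 0")
            case False
            then have y0: "y 0 > 0"
              using standard_simplex_Suc_bounds(1)[OF elim(3), of 0] by simp
            have "of_int (\<bar>u\<bar> + int m + 1) \<le> 1 / y 0"
              using elim(1) y0 by (simp add: field_simps)
            then have "\<bar>u\<bar> + int m + 1 \<le> \<lfloor>1 / y 0\<rfloor>"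
              by (simp only: le_floor_iff)
            then have "clamp (\<lfloor>1 / y 0\<rfloor> - 1) ?v = ?v"
              using elim(2) by (intro clamp_id) linarith
            then show ?thesis using elim(2) True by (simp add: u_def)
          qed (use elim(2) True in \<open>simp add: u_def\<close>)
        qed
      next
        case False
        then have x0: "x 0 > 0"
          using standard_simplex_Suc_bounds(1)[OF x, of 0] by simp
        have inv: "filterlim (\<lambda>y. 1 / y 0) (nhds (1 / x 0)) (at x within ?S)"
          using lim False by (intro tendsto_intros) auto
        have "\<forall>\<^sub>F y in at x within ?S. 1 / y 0 < 1 / x 0 + 1"
          "\<forall>\<^sub>F y in at x within ?S. 1 / x 0 - 1 < 1 / y 0"
          "\<forall>\<^sub>F y in at x within ?S. 0 < y 0"
          using order_tendstoD(2)[OF inv, of "1 / x 0 + 1"] order_tendstoD(1)[OF inv, of "1 / x 0 - 1"]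
            order_tendstoD(1)[OF lim x0] by auto
        then show ?thesis
          using near inS
        proof eventually_elim
          case (elim y)
          have "1 \<le> 1 / x 0" "1 \<le> 1 / y 0"
            using x0 elim(3) standard_simplex_Suc_bounds(2)[OF x, of 0]
              standard_simplex_Suc_bounds(2)[OF elim(5), of 0] by (auto simp: field_simps)
          then have fl: "1 \<le> \<lfloor>1 / x 0\<rfloor>" "1 \<le> \<lfloor>1 / y 0\<rfloor>"
            by (simp_all add: le_floor_iff)
          have "\<bar>(\<lfloor>1 / y 0\<rfloor> - 1) - (\<lfloor>1 / x 0\<rfloor> - 1)\<bar> \<le> 1"
            using elim(1,2) by linarith
          then have "\<bar>clamp (\<lfloor>1 / y 0\<rfloor> - 1) (\<sigma> (cone_base_point y)) - clamp (\<lfloor>1 / x 0\<rfloor> - 1) u\<bar> \<le> int m"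
            using elim(4) fl m by (intro clamp_step) auto
          then show ?case
            using x0 elim(3) by (simp add: u_def)
        qed
      qed
    qed
  qed
  then have "step_continuous_on m ?S (step_cone p \<sigma>)"
    by (rule step_continuous_on_cong[rotated]) (simp add: step_cone_def)
  then show ?thesis
    by (simp add: step_simplices_def step_cone_def)
qed

lemma singular_face_step_cone_0:
  assumes "\<sigma> \<in> extensional (standard_simplex p)"
  shows "singular_face (Suc p) 0 (step_cone p \<sigma>) = \<sigma>"
proof
  fix x
  show "singular_face (Suc p) 0 (step_cone p \<sigma>) x = \<sigma> x"
  proof (cases "x \<in> standard_simplex p")
    case True
    then have "simplical_face 0 x \<in> standard_simplex (Suc p)"
      using simplical_face_in_standard_simplex[of "Suc p" 0 x] by simp
    moreover have "cone_base_point (simplical_face 0 x) = x"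
      by (simp add: cone_base_point_def simplical_face_def)
    ultimately show ?thesis
      using True by (simp add: singular_face_def step_cone_def simplical_face_def)
  next
    case False
    then show ?thesis using assms by (simp add: singular_face_def extensional_def)
  qed
qed

lemma singular_face_step_cone_Suc:
  assumes "1 \<le> p" "k \<le> p"
  shows "singular_face (Suc p) (Suc k) (step_cone p \<sigma>) =
         step_cone (p - 1) (singular_face p k \<sigma>)"
proof
  fix x
  have p: "Suc (p - Suc 0) = p" using assms by simp
  show "singular_face (Suc p) (Suc k) (step_cone p \<sigma>) x = step_cone (p - 1) (singular_face p k \<sigma>) x"
  proof (cases "x \<in> standard_simplex p")
    case True
    then have face: "simplical_face (Suc k) x \<in> standard_simplex (Suc p)"
      using simplical_face_in_standard_simplex[of "Suc p" "Suc k" x] assms by simp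
    have base: "cone_base_point (simplical_face (Suc k) x) = simplical_face k (cone_base_point x)"
    proof
      fix i
      show "cone_base_point (simplical_face (Suc k) x) i = simplical_face k (cone_base_point x) i"
        by (cases i) (simp_all add: cone_base_point_def simplical_face_def)
    qed
    have zero: "simplical_face (Suc k) x 0 = x 0"
      by (simp add: simplical_face_def)
    have "x 0 \<le> 1"
      using standard_simplex_Suc_bounds(2)[of x "p - Suc 0" 0] True p by simp
    then consider "x 0 = 1" | "x 0 < 1" by linarith
    then show ?thesis
    proof cases
      case 1
      then show ?thesis
        using True p face zero by (simp add: singular_face_def step_cone_def clamp_def)
    next
      case 2
      then have "cone_base_point x \<in> standard_simplex (p - Suc 0)"
        using cone_base_point_in_simplex[of x "p - Suc 0"] True p by simp
      then show ?thesis
        using True p face zero base by (simp add: singular_face_def step_cone_def)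
    qed
  next
    case False
    then show ?thesis using p by (simp add: singular_face_def step_cone_def)
  qed
qed

lemma singular_face_step_cone_vertex:
  "singular_face (Suc 0) (Suc 0) (step_cone 0 \<sigma>) = restrict (\<lambda>_. 0) (standard_simplex 0)"
proof
  fix x :: "nat \<Rightarrow> real"
  show "singular_face (Suc 0) (Suc 0) (step_cone 0 \<sigma>) x = restrict (\<lambda>_. 0) (standard_simplex 0) x"
  proof (cases "x \<in> standard_simplex 0")
    case True
    then have "simplical_face (Suc 0) x \<in> standard_simplex (Suc 0)"
      using simplical_face_in_standard_simplex[of "Suc 0" "Suc 0" x] by simp
    moreover have "simplical_face (Suc 0) x 0 = 1"
      using True by (simp add: simplical_face_def standard_simplex_0)
    ultimately show ?thesis
      using True by (simp add: singular_face_def step_cone_def clamp_def)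
  qed (simp add: singular_face_def)
qed

definition chain_cone :: "nat \<Rightarrow> int chain \<Rightarrow> int chain" where
  "chain_cone p = frag_extend (frag_of \<circ> step_cone p)"

lemma chain_cone_0 [simp]: "chain_cone p 0 = 0"
  by (simp add: chain_cone_def)

lemma chain_cone_diff: "chain_cone p (a - b) = chain_cone p a - chain_cone p b"
  by (simp add: chain_cone_def frag_extend_diff)

text \<open>The additive extension of an integer weight on the basis; passing through the free group on one
  generator makes additivity an instance of the laws for \<^const>\<open>frag_extend\<close>.\<close>

definition weighted_sum :: "('a \<Rightarrow> int) \<Rightarrow> ('a \<Rightarrow>\<^sub>0 int) \<Rightarrow> int" where
  "weighted_sum w c = Poly_Mapping.lookup (frag_extend (\<lambda>x. frag_cmul (w x) (frag_of ())) c) ()"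

lemma weighted_sum_0 [simp]: "weighted_sum w 0 = 0"
  by (simp add: weighted_sum_def)

lemma weighted_sum_of [simp]: "weighted_sum w (frag_of x) = w x"
  by (simp add: weighted_sum_def)

lemma weighted_sum_add: "weighted_sum w (a + b) = weighted_sum w a + weighted_sum w b"
  by (simp add: weighted_sum_def frag_extend_add lookup_add)

lemma weighted_sum_diff: "weighted_sum w (a - b) = weighted_sum w a - weighted_sum w b"
  by (simp add: weighted_sum_def frag_extend_diff lookup_minus)

lemma weighted_sum_cmul: "weighted_sum w (frag_cmul k a) = k * weighted_sum w a"
  by (simp add: weighted_sum_def frag_extend_cmul)

definition augmentation :: "'a chain \<Rightarrow> int" where
  "augmentation = weighted_sum (\<lambda>_. 1)"

definition step_chains :: "nat \<Rightarrow> nat \<Rightarrow> int chain set" where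
  "step_chains m p = {c. Poly_Mapping.keys c \<subseteq> step_simplices m p}"

text \<open>Face \<open>0\<close> of a cone is its base, and face \<open>Suc k\<close> is the cone over face \<open>k\<close> of the base. Hence
  the cone operator is a contracting homotopy in positive degrees.\<close>

lemma chain_boundary_chain_cone:
  assumes "c \<in> step_chains m p" "1 \<le> p"
  shows "chain_boundary (Suc p) (chain_cone p c) = c - chain_cone (p - 1) (chain_boundary p c)"
  using assms(1) unfolding step_chains_def mem_Collect_eq
proof (induction c rule: frag_induction)
  case (one \<sigma>)
  have "chain_boundary (Suc p) (chain_cone p (frag_of \<sigma>)) =
      (\<Sum>k\<le>Suc p. frag_cmul ((-1) ^ k) (frag_of (singular_face (Suc p) k (step_cone p \<sigma>))))"
    by (simp add: chain_cone_def chain_boundary_of)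
  also have "\<dots> = frag_of (singular_face (Suc p) 0 (step_cone p \<sigma>)) +
      (\<Sum>k\<le>p. frag_cmul ((-1) ^ Suc k) (frag_of (singular_face (Suc p) (Suc k) (step_cone p \<sigma>))))"
    by (subst sum.atMost_Suc_shift) simp
  also have "frag_of (singular_face (Suc p) 0 (step_cone p \<sigma>)) = frag_of \<sigma>"
    using one by (subst singular_face_step_cone_0) (auto simp: step_simplices_def)
  also have "(\<Sum>k\<le>p. frag_cmul ((-1) ^ Suc k) (frag_of (singular_face (Suc p) (Suc k) (step_cone p \<sigma>)))) =
      - (\<Sum>k\<le>p. frag_cmul ((-1) ^ k) (frag_of (step_cone (p - 1) (singular_face p k \<sigma>))))"
    unfolding sum_negf[symmetric]
    by (rule sum.cong) (use assms(2) singular_face_step_cone_Suc in auto)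
  also have "(\<Sum>k\<le>p. frag_cmul ((-1) ^ k) (frag_of (step_cone (p - 1) (singular_face p k \<sigma>)))) =
      chain_cone (p - 1) (chain_boundary p (frag_of \<sigma>))"
    using assms(2) by (simp add: chain_cone_def chain_boundary_of frag_extend_sum frag_extend_cmul)
  finally show ?case by simp
qed (simp_all add: chain_boundary_diff chain_cone_diff)

text \<open>In degree \<open>0\<close> the second face of a cone is its apex, and the contraction is onto that point.\<close>

lemma chain_boundary_chain_cone_0:
  assumes "c \<in> step_chains m 0"
  shows "chain_boundary 1 (chain_cone 0 c) =
    c - frag_cmul (augmentation c) (frag_of (restrict (\<lambda>_. 0) (standard_simplex 0)))"
  using assms unfolding step_chains_def mem_Collect_eq
proof (induction c rule: frag_induction)
  case (one \<sigma>)
  then have "singular_face (Suc 0) 0 (step_cone 0 \<sigma>) = \<sigma>"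
    by (subst singular_face_step_cone_0) (auto simp: step_simplices_def)
  then show ?case
    by (simp add: chain_cone_def chain_boundary_of augmentation_def singular_face_step_cone_vertex
        del: restrict_apply)
qed (simp_all add: chain_boundary_diff chain_cone_diff augmentation_def weighted_sum_diff
    frag_cmul_diff_distrib)

lemma chain_cone_in_step_chains:
  assumes "c \<in> step_chains m p" "1 \<le> m"
  shows "chain_cone p c \<in> step_chains m (Suc p)"
  using assms step_cone_in_step_simplices
    keys_frag_extend[of "frag_of \<circ> step_cone p" c]
  by (fastforce simp: step_chains_def chain_cone_def keys_frag_of)

text \<open>The line is acyclic, with an explicit choice of bounding chains.\<close>

lemma step_cycle_imp_boundary:
  assumes c: "c \<in> step_chains m p" and m: "1 \<le> m"
    and "if p = 0 then augmentation c = 0 else chain_boundary p c = 0"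
  shows "chain_cone p c \<in> step_chains m (Suc p) \<and> chain_boundary (Suc p) (chain_cone p c) = c"
  using chain_cone_in_step_chains[OF c m] chain_boundary_chain_cone[OF c]
    chain_boundary_chain_cone_0[of c m] assms
  by (cases "p = 0") auto

section \<open>Singular simplices of the cyclic closure spaces\<close>

definition cyclic_simplices :: "nat \<Rightarrow> nat \<Rightarrow> nat \<Rightarrow> ((nat \<Rightarrow> real) \<Rightarrow> int) set" where
  "cyclic_simplices n m p =
     {f \<in> extensional (standard_simplex p).
        f \<in> standard_simplex p \<rightarrow> cyclic_set n \<and> cyclic_continuous_on n m (standard_simplex p) f}"

lemma cyclic_dist_le_iff:
  "cyclic_dist n i j \<le> int m \<longleftrightarrow> (\<exists>k. \<bar>k\<bar> \<le> int m \<and> int n dvd i - j - k)"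
proof -
  have "[k = i - j] (mod int n) \<longleftrightarrow> int n dvd i - j - k" for k
    by (metis cong_iff_dvd_diff cong_sym_eq)
  then show ?thesis
    using cyclic_dist_is_minimum[of i j n] by (metis order_trans)
qed

lemma closure_of_simplex_topology:
  "A \<subseteq> standard_simplex p \<Longrightarrow> simplex_topology p closure_of A = standard_simplex p \<inter> closure A"
  unfolding euclidean_product_topology closure_of_subtopology euclidean_closure_of
  by (simp only: inf.absorb2)

text \<open>As the target is finite, the condition on closures of sets reduces to fibres: \<open>x\<close> lies
  outside the closure of the fibre of every value that is far from \<open>f x\<close>, and finitely many such
  closures leave a neighbourhood of \<open>x\<close>.\<close>

lemma closure_continuous_cyclic_iff:
  "closure_continuous (standard_simplex p) ((closure_of) (simplex_topology p))
     (cyclic_set n) (cyclic_closure n m) f \<longleftrightarrow>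
   f \<in> standard_simplex p \<rightarrow> cyclic_set n \<and> cyclic_continuous_on n m (standard_simplex p) f"
    (is "?L \<longleftrightarrow> ?R")
proof
  let ?S = "standard_simplex p"
  assume L: ?L
  then have fX: "f \<in> ?S \<rightarrow> cyclic_set n"
    unfolding closure_continuous_def by (rule conjunct1)
  have cl: "f x \<in> cyclic_closure n m (f ` A)" if A: "A \<subseteq> ?S" "x \<in> ?S" "x \<in> closure A" for A x
  proof -
    have "f ` (simplex_topology p closure_of A) \<subseteq> cyclic_closure n m (f ` A)"
      using L A(1) unfolding closure_continuous_def by blast
    then show ?thesis
      using A unfolding closure_of_simplex_topology[OF A(1)] by blast
  qed
  have "cyclic_continuous_on n m ?S f"
    unfolding cyclic_continuous_on_def
  proof
    fix x assume x: "x \<in> ?S"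
    define near where "near v \<longleftrightarrow> (\<exists>k. \<bar>k\<bar> \<le> int m \<and> int n dvd v - f x - k)" for v
    have "\<forall>v\<in>cyclic_set n. \<forall>\<^sub>F y in at x within ?S. f y = v \<longrightarrow> near v"
    proof
      fix v assume "v \<in> cyclic_set n"
      show "\<forall>\<^sub>F y in at x within ?S. f y = v \<longrightarrow> near v"
      proof (cases "near v")
        case False
        let ?A = "{y \<in> ?S. f y = v}"
        have "x \<notin> closure ?A"
        proof
          assume "x \<in> closure ?A"
          then have "f x \<in> cyclic_closure n m (f ` ?A)"
            by (intro cl x) auto
          then obtain i where "i \<in> f ` ?A" "cyclic_dist n i (f x) \<le> int m"
            unfolding cyclic_closure_def by blast
          then have "cyclic_dist n v (f x) \<le> int m" by blast
          then show False
            using False unfolding cyclic_dist_le_iff near_def by contradiction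
        qed
        then have "\<forall>\<^sub>F y in nhds x. y \<in> - closure ?A"
          by (intro eventually_nhds_in_open) auto
        then show ?thesis
          unfolding eventually_at_filter
        proof eventually_elim
          case (elim y)
          then have "y \<notin> ?A" using closure_subset[of ?A] by auto
          then show ?case by simp
        qed
      qed simp
    qed
    then have "\<forall>\<^sub>F y in at x within ?S. \<forall>v\<in>cyclic_set n. f y = v \<longrightarrow> near v"
      by (intro eventually_ball_finite) (auto simp: cyclic_set_def)
    then have "\<forall>\<^sub>F y in at x within ?S. near (f y)"
      unfolding eventually_at_filter by eventually_elim (use fX in auto)
    then show "\<forall>\<^sub>F y in at x within ?S. \<exists>k. \<bar>k\<bar> \<le> int m \<and> int n dvd f y - f x - k"
      unfolding near_def .
  qed
  with fX show ?R by simp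
next
  let ?S = "standard_simplex p"
  assume R: ?R
  have "f x \<in> cyclic_closure n m (f ` A)" if A: "A \<subseteq> ?S" and x: "x \<in> ?S" "x \<in> closure A" for A x
  proof -
    have "\<forall>\<^sub>F y in at x within ?S. \<exists>k. \<bar>k\<bar> \<le> int m \<and> int n dvd f y - f x - k"
      using R x unfolding cyclic_continuous_on_def by blast
    then obtain U where U: "open U" "x \<in> U"
      and near: "\<And>y. y \<in> U \<Longrightarrow> y \<noteq> x \<Longrightarrow> y \<in> ?S \<Longrightarrow> \<exists>k. \<bar>k\<bar> \<le> int m \<and> int n dvd f y - f x - k"
      unfolding eventually_at_topological by metis
    obtain y where y: "y \<in> A" "y \<in> U"
      using open_Int_closure_eq_empty[OF U(1), of A] U(2) x(2) by blast
    have "cyclic_dist n (f y) (f x) \<le> int m"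
    proof (cases "y = x")
      case True
      then show ?thesis unfolding cyclic_dist_le_iff by (intro exI[of _ 0]) simp
    next
      case False
      then show ?thesis unfolding cyclic_dist_le_iff using near y A by blast
    qed
    moreover have "f x \<in> cyclic_set n" using R x by blast
    ultimately show ?thesis using y(1) unfolding cyclic_closure_def by blast
  qed
  then have "f ` (simplex_topology p closure_of A) \<subseteq> cyclic_closure n m (f ` A)"
    if "A \<subseteq> ?S" for A
    unfolding closure_of_simplex_topology[OF that] using that by blast
  then show ?L
    using R unfolding closure_continuous_def by blast
qed

lemma closure_singular_simplices_cyclic:
  "closure_singular_simplices p (cyclic_set n) (cyclic_closure n m) = cyclic_simplices n m p"
  unfolding closure_singular_simplices_def closure_continuous_cyclic_iff cyclic_simplices_def
  by blast

section \<open>Boundaries, faces and induced maps\<close>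

lemma chain_boundary_chain_map_gen:
  "chain_boundary p (chain_map p g c) = chain_map (p - Suc 0) g (chain_boundary p c)"
  using subset_UNIV[of "Poly_Mapping.keys c"]
proof (induction c rule: frag_induction)
  case (one \<sigma>)
  have "simplex_map (p - Suc 0) g (\<sigma> \<circ> simplical_face k) = simplex_map (p - Suc 0) g (singular_face p k \<sigma>)" for k
    by (auto simp: simplex_map_def singular_face_def)
  then show ?case
    by (auto simp: chain_boundary_of chain_map_sum singular_face_simplex_map intro!: sum.cong)
qed (simp_all add: chain_boundary_diff chain_map_diff)

text \<open>Every extensional map is a singular simplex of the indiscrete space on the target type, so the
  identity is an instance of the one for topological spaces.\<close>

lemma chain_boundary_boundary_extensional:
  assumes "Poly_Mapping.keys c \<subseteq> extensional (standard_simplex (Suc p))"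
  shows "chain_boundary p (chain_boundary (Suc p) c) = 0"
proof (rule chain_boundary_boundary_alt)
  let ?X = "pullback_topology UNIV (\<lambda>_. ()) (discrete_topology UNIV)"
  have "continuous_map T ?X f" for T :: "(nat \<Rightarrow> real) topology" and f :: "(nat \<Rightarrow> real) \<Rightarrow> 'a"
    by (rule continuous_map_pullback') (auto simp: comp_def)
  then show "singular_chain (Suc p) ?X c"
    using assms by (auto simp: singular_chain_def singular_simplex_def)
qed

lemma augmentation_boundary: "augmentation (chain_boundary (Suc 0) c) = 0"
  using subset_UNIV[of "Poly_Mapping.keys c"]
  by (induction c rule: frag_induction)
    (simp_all add: augmentation_def chain_boundary_of chain_boundary_diff weighted_sum_diff)

lemma continuous_on_simplical_face: "continuous_on S (simplical_face k :: (nat \<Rightarrow> real) \<Rightarrow> _)"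
proof (rule continuous_on_coordinatewise_then_product)
  fix i
  consider "i < k" | "i = k" | "i > k" by linarith
  then show "continuous_on S (\<lambda>x::nat \<Rightarrow> real. simplical_face k x i)"
    by cases (simp_all add: simplical_face_def continuous_on_coordinate)
qed

lemma step_simplices_face:
  assumes "F \<in> step_simplices m (Suc p)" "k \<le> Suc p"
  shows "singular_face (Suc p) k F \<in> step_simplices m p"
proof -
  have "step_continuous_on m (standard_simplex p) (F \<circ> simplical_face k)"
  proof (rule step_continuous_on_compose)
    show "step_continuous_on m (standard_simplex (Suc p)) F"
      using assms by (simp add: step_simplices_def)
    show "simplical_face k ` standard_simplex p \<subseteq> standard_simplex (Suc p)"
      using simplical_face_in_standard_simplex[of "Suc p" k] assms by auto
  qed (rule continuous_on_simplical_face)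
  then have "step_continuous_on m (standard_simplex p) (singular_face (Suc p) k F)"
    by (rule step_continuous_on_cong[rotated]) (simp add: singular_face_def)
  then show ?thesis by (simp add: step_simplices_def singular_face_def)
qed

lemma step_chains_0 [simp]: "0 \<in> step_chains m p"
  by (simp add: step_chains_def)

lemma step_chains_of [simp]: "frag_of F \<in> step_chains m p \<longleftrightarrow> F \<in> step_simplices m p"
  by (simp add: step_chains_def keys_frag_of)

lemma step_chains_diff: "a \<in> step_chains m p \<Longrightarrow> b \<in> step_chains m p \<Longrightarrow> a - b \<in> step_chains m p"
  using keys_diff[of a b] by (auto simp: step_chains_def)

lemma step_chains_cmul: "a \<in> step_chains m p \<Longrightarrow> frag_cmul k a \<in> step_chains m p"
  using keys_cmul by (fastforce simp: step_chains_def)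

lemma step_chains_add: "a \<in> step_chains m p \<Longrightarrow> b \<in> step_chains m p \<Longrightarrow> a + b \<in> step_chains m p"
  using keys_add[of a b] by (auto simp: step_chains_def)

lemma step_chains_sum: "(\<And>i. i \<in> I \<Longrightarrow> f i \<in> step_chains m p) \<Longrightarrow> sum f I \<in> step_chains m p"
  by (induction I rule: infinite_finite_induct) (auto simp: step_chains_add)

lemma step_chains_extend:
  assumes "Poly_Mapping.keys c \<subseteq> A" "\<And>x. x \<in> A \<Longrightarrow> f x \<in> step_chains m p"
  shows "frag_extend f c \<in> step_chains m p"
  using assms by (induction c rule: frag_induction) (auto simp: frag_extend_diff step_chains_diff)

lemma step_chains_boundary:
  assumes "c \<in> step_chains m (Suc p)"
  shows "chain_boundary (Suc p) c \<in> step_chains m p"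
  using assms unfolding chain_boundary_def step_chains_def[of m "Suc p"]
  by (auto intro!: step_chains_extend[where A = "step_simplices m (Suc p)"] step_chains_sum
      step_chains_cmul step_simplices_face simp del: sum.atMost_Suc)

lemma step_chains_boundary_boundary:
  "c \<in> step_chains m (Suc p) \<Longrightarrow> chain_boundary p (chain_boundary (Suc p) c) = 0"
  by (rule chain_boundary_boundary_extensional) (auto simp: step_chains_def step_simplices_def)

section \<open>The covering of the circle by the line\<close>

text \<open>The bound \<open>3 * m < n\<close> makes the reduction modulo \<open>n\<close> a covering map from the line to the cyclic
  closure space, with the translations by multiples of \<open>n\<close> as deck transformations.\<close>

locale cyclic_cover =
  fixes n m :: nat
  assumes m_pos: "1 \<le> m" and n_large: "3 * m < n"
begin

lemma n_pos: "0 < n"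
  using n_large by simp

definition cyclic_chains :: "nat \<Rightarrow> int chain set" where
  "cyclic_chains p = {c. Poly_Mapping.keys c \<subseteq> cyclic_simplices n m p}"

abbreviation proj_simplex :: "nat \<Rightarrow> ((nat \<Rightarrow> real) \<Rightarrow> int) \<Rightarrow> (nat \<Rightarrow> real) \<Rightarrow> int" where
  "proj_simplex p \<equiv> simplex_map p (\<lambda>z. z mod int n)"

abbreviation deck_simplex :: "nat \<Rightarrow> int \<Rightarrow> ((nat \<Rightarrow> real) \<Rightarrow> int) \<Rightarrow> (nat \<Rightarrow> real) \<Rightarrow> int" where
  "deck_simplex p j \<equiv> simplex_map p (\<lambda>z. z + j * int n)"

abbreviation proj :: "nat \<Rightarrow> int chain \<Rightarrow> int chain" where
  "proj p \<equiv> chain_map p (\<lambda>z. z mod int n)"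

abbreviation deck :: "nat \<Rightarrow> int chain \<Rightarrow> int chain" where
  "deck p \<equiv> chain_map p (\<lambda>z. z + int n)"

lemma dvd_mod_minus: "int n dvd a mod int n - a"
  by (simp flip: mod_eq_dvd_iff)

lemma proj_simplex_in:
  assumes "F \<in> step_simplices m p"
  shows "proj_simplex p F \<in> cyclic_simplices n m p"
proof -
  let ?S = "standard_simplex p"
  have F: "step_continuous_on m ?S F" using assms by (simp add: step_simplices_def)
  have "cyclic_continuous_on n m ?S (proj_simplex p F)"
    unfolding cyclic_continuous_on_def
  proof
    fix x assume x: "x \<in> ?S"
    then have "\<forall>\<^sub>F y in at x within ?S. \<bar>F y - F x\<bar> \<le> int m"
      using F unfolding step_continuous_on_def by blast
    then show "\<forall>\<^sub>F y in at x within ?S.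
        \<exists>k. \<bar>k\<bar> \<le> int m \<and> int n dvd proj_simplex p F y - proj_simplex p F x - k"
      unfolding eventually_at_filter
    proof eventually_elim
      case (elim y)
      show ?case
      proof (intro impI exI conjI)
        assume y: "y \<noteq> x" "y \<in> ?S"
        show "\<bar>F y - F x\<bar> \<le> int m" using elim y by blast
        have "int n dvd (F y mod int n - F y) - (F x mod int n - F x)"
          by (intro dvd_diff dvd_mod_minus)
        moreover have "(F y mod int n - F y) - (F x mod int n - F x) =
            F y mod int n - F x mod int n - (F y - F x)" by simp
        ultimately have "int n dvd F y mod int n - F x mod int n - (F y - F x)"
          by (simp only:)
        then show "int n dvd proj_simplex p F y - proj_simplex p F x - (F y - F x)"
          using x y(2) by (simp add: simplex_map_def)
      qed
    qed
  qed
  then show ?thesis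
    using n_pos by (auto simp: cyclic_simplices_def simplex_map_def cyclic_set_def)
qed

lemma exists_lift:
  assumes "f \<in> cyclic_simplices n m p"
  shows "\<exists>F. F \<in> step_simplices m p \<and> proj_simplex p F = f"
proof -
  let ?S = "standard_simplex p"
  have f: "f \<in> extensional ?S" "f \<in> ?S \<rightarrow> cyclic_set n" "cyclic_continuous_on n m ?S f"
    using assms by (auto simp: cyclic_simplices_def)
  obtain F where F: "step_continuous_on m ?S F" "\<And>x. x \<in> ?S \<Longrightarrow> int n dvd F x - f x"
    using has_step_lift_standard_simplex[OF f(3) n_large] unfolding has_step_lift_def by blast
  have val: "F x mod int n = f x" if "x \<in> ?S" for x
  proof -
    have "F x mod int n = f x mod int n"
      using F(2)[OF that] by (simp only: mod_eq_dvd_iff)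
    also have "\<dots> = f x" using f(2) that by (intro mod_pos_pos_trivial) (auto simp: cyclic_set_def Pi_iff)
    finally show ?thesis .
  qed
  have "step_continuous_on m ?S (restrict F ?S)"
    using F(1) by (rule step_continuous_on_cong[rotated]) simp
  moreover have "proj_simplex p (restrict F ?S) = f"
  proof
    fix x show "proj_simplex p (restrict F ?S) x = f x"
      using val f(1) by (cases "x \<in> ?S") (auto simp: simplex_map_def extensional_def)
  qed
  ultimately show ?thesis
    by (intro exI[of _ "restrict F ?S"]) (simp add: step_simplices_def)
qed

lemma lift_unique:
  assumes F: "F \<in> step_simplices m p" and G: "G \<in> step_simplices m p"
    and eq: "proj_simplex p F = proj_simplex p G"
  shows "\<exists>j. G = deck_simplex p j F"
proof -
  let ?S = "standard_simplex p"
  have "\<exists>j. \<forall>x\<in>?S. G x = F x + j * int n"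
  proof (rule step_continuous_lift_unique)
    show "connected ?S"
      by (intro segment_closed_imp_connected segment_closed_standard_simplex)
    show "int n dvd G x - F x" if "x \<in> ?S" for x
      using fun_cong[OF eq, of x] that by (simp add: simplex_map_def flip: mod_eq_dvd_iff)
  qed (use F G n_large in \<open>auto simp: step_simplices_def\<close>)
  then obtain j where j: "\<And>x. x \<in> ?S \<Longrightarrow> G x = F x + j * int n" by blast
  have "G = deck_simplex p j F"
  proof
    fix x show "G x = deck_simplex p j F x"
      using j G by (cases "x \<in> ?S") (auto simp: simplex_map_def step_simplices_def extensional_def)
  qed
  then show ?thesis by blast
qed

lemma deck_simplex_in:
  assumes "F \<in> step_simplices m p"
  shows "deck_simplex p j F \<in> step_simplices m p"
proof -
  have "step_continuous_on m (standard_simplex p) (\<lambda>x. F x + j * int n)"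
    using assms by (simp add: step_simplices_def step_continuous_on_shift)
  then have "step_continuous_on m (standard_simplex p) (deck_simplex p j F)"
    by (rule step_continuous_on_cong[rotated]) (simp add: simplex_map_def)
  then show ?thesis by (simp add: step_simplices_def simplex_map_def)
qed

definition lift :: "nat \<Rightarrow> ((nat \<Rightarrow> real) \<Rightarrow> int) \<Rightarrow> (nat \<Rightarrow> real) \<Rightarrow> int" where
  "lift p f = (SOME F. F \<in> step_simplices m p \<and> proj_simplex p F = f)"

lemma lift_in: "f \<in> cyclic_simplices n m p \<Longrightarrow> lift p f \<in> step_simplices m p"
  and proj_lift: "f \<in> cyclic_simplices n m p \<Longrightarrow> proj_simplex p (lift p f) = f"
  using someI_ex[OF exists_lift] by (simp_all add: lift_def)

text \<open>A section of the projection on chains in each degree; it is not a chain map, and its failure to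
  commute with boundaries is what detects the loop around the circle.\<close>

definition lift_chain :: "nat \<Rightarrow> int chain \<Rightarrow> int chain" where
  "lift_chain p = frag_extend (frag_of \<circ> lift p)"

lemma lift_chain_add: "lift_chain p (a + b) = lift_chain p a + lift_chain p b"
  by (simp add: lift_chain_def frag_extend_add)

lemma lift_chain_diff: "lift_chain p (a - b) = lift_chain p a - lift_chain p b"
  by (simp add: lift_chain_def frag_extend_diff)

lemma lift_chain_cmul: "lift_chain p (frag_cmul k a) = frag_cmul k (lift_chain p a)"
  by (simp add: lift_chain_def frag_extend_cmul)

lemma lift_chain_0 [simp]: "lift_chain p 0 = 0"
  by (simp add: lift_chain_def)

lemma lift_chain_of [simp]: "lift_chain p (frag_of f) = frag_of (lift p f)"
  by (simp add: lift_chain_def)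

lemma lift_chain_in: "z \<in> cyclic_chains p \<Longrightarrow> lift_chain p z \<in> step_chains m p"
  unfolding lift_chain_def cyclic_chains_def
  by (rule step_chains_extend) (auto intro: lift_in)

lemma proj_lift_chain:
  assumes "z \<in> cyclic_chains p"
  shows "proj p (lift_chain p z) = z"
  using assms unfolding cyclic_chains_def mem_Collect_eq
  by (induction z rule: frag_induction)
    (simp_all add: lift_chain_diff chain_map_diff proj_lift)

lemma augmentation_lift_chain: "augmentation (lift_chain p z) = augmentation z"
  using subset_UNIV[of "Poly_Mapping.keys z"]
  by (induction z rule: frag_induction)
    (simp_all add: augmentation_def lift_chain_diff weighted_sum_diff)

lemma cyclic_chains_diff:
  "a \<in> cyclic_chains p \<Longrightarrow> b \<in> cyclic_chains p \<Longrightarrow> a - b \<in> cyclic_chains p"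
  using keys_diff[of a b] by (auto simp: cyclic_chains_def)

lemma proj_in:
  assumes "c \<in> step_chains m p" shows "proj p c \<in> cyclic_chains p"
  using assms unfolding step_chains_def mem_Collect_eq
proof (induction c rule: frag_induction)
  case (one F)
  then show ?case using proj_simplex_in by (simp add: cyclic_chains_def keys_frag_of)
qed (simp_all add: chain_map_diff cyclic_chains_diff, simp add: cyclic_chains_def)

lemma deck_in:
  assumes "Poly_Mapping.keys c \<subseteq> step_simplices m p" shows "deck p c \<in> step_chains m p"
  using assms
proof (induction c rule: frag_induction)
  case (one F)
  then show ?case using deck_simplex_in[of F p 1] by simp
qed (simp_all add: chain_map_diff step_chains_diff)

lemma proj_deck: "proj p (deck p c) = proj p c"
proof -
  have "proj p \<circ> deck p = chain_map p ((\<lambda>z. z mod int n) \<circ> (\<lambda>z. z + int n))"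
    by (simp add: chain_map_compose)
  also have "(\<lambda>z. z mod int n) \<circ> (\<lambda>z. z + int n) = (\<lambda>z. z mod int n)"
    by (simp add: fun_eq_iff)
  finally show ?thesis by (simp add: fun_eq_iff)
qed

text \<open>The image of \<open>1 - T\<close>, where \<open>T\<close> is the chain map of the generating deck transformation.\<close>

definition deck_coboundary :: "nat \<Rightarrow> int chain set" where
  "deck_coboundary p = (\<lambda>b. b - deck p b) ` step_chains m p"

lemma deck_coboundary_diff:
  assumes "a \<in> deck_coboundary p" "b \<in> deck_coboundary p"
  shows "a - b \<in> deck_coboundary p"
proof -
  obtain c d where "c \<in> step_chains m p" "a = c - deck p c" "d \<in> step_chains m p" "b = d - deck p d"
    using assms by (auto simp: deck_coboundary_def)
  then show ?thesis
    unfolding deck_coboundary_def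
    by (intro image_eqI[of _ _ "c - d"]) (simp_all add: chain_map_diff step_chains_diff)
qed

lemma deck_coboundary_0: "0 \<in> deck_coboundary p"
  unfolding deck_coboundary_def by (rule image_eqI[of _ _ 0]) simp_all

lemma deck_coboundary_add:
  assumes "a \<in> deck_coboundary p" "b \<in> deck_coboundary p"
  shows "a + b \<in> deck_coboundary p"
  using deck_coboundary_diff[OF assms(1) deck_coboundary_diff[OF deck_coboundary_0 assms(2)]] by simp

lemma deck_step:
  assumes "F \<in> step_simplices m p"
  shows "frag_of F - frag_of (deck_simplex p 1 F) \<in> deck_coboundary p"
  unfolding deck_coboundary_def
  by (rule image_eqI[of _ _ "frag_of F"]) (use assms in simp_all)

lemma deck_simplex_add: "deck_simplex p i (deck_simplex p j F) = deck_simplex p (i + j) F"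
  by (auto simp: simplex_map_def algebra_simps)

lemma deck_simplex_0: "F \<in> step_simplices m p \<Longrightarrow> deck_simplex p 0 F = F"
  by (auto simp: simplex_map_def step_simplices_def extensional_def)

lemma deck_translate_coboundary:
  assumes F: "F \<in> step_simplices m p"
  shows "frag_of F - frag_of (deck_simplex p j F) \<in> deck_coboundary p"
proof (induction j rule: int_induct[where k = 0])
  case base
  show ?case by (simp only: deck_simplex_0[OF F] diff_self deck_coboundary_0)
next
  case (step1 j)
  have "frag_of (deck_simplex p j F) - frag_of (deck_simplex p (j + 1) F) \<in> deck_coboundary p"
    using deck_step[OF deck_simplex_in[OF F, of j]] by (simp add: deck_simplex_add add.commute del: mult_1)
  from deck_coboundary_add[OF step1(2) this] show ?case by simp
next
  case (step2 j)
  have "frag_of (deck_simplex p (j - 1) F) - frag_of (deck_simplex p j F) \<in> deck_coboundary p"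
    using deck_step[OF deck_simplex_in[OF F, of "j - 1"]] by (simp add: deck_simplex_add del: mult_1)
  from deck_coboundary_diff[OF step2(2) this] show ?case by simp
qed

text \<open>A simplex and the chosen lift of its projection differ by a deck transformation \<open>T\<^sup>j\<close>, and
  \<open>1 - T\<^sup>j\<close> is divisible by \<open>1 - T\<close>. In particular the kernel of the projection is the image of
  \<open>1 - T\<close>, which is exactness of \<open>0 \<rightarrow> C \<rightarrow> C \<rightarrow> D \<rightarrow> 0\<close> in the middle.\<close>

lemma lift_proj_coboundary:
  assumes "c \<in> step_chains m p"
  shows "c - lift_chain p (proj p c) \<in> deck_coboundary p"
  using assms unfolding step_chains_def mem_Collect_eq
proof (induction c rule: frag_induction)
  case (one F)
  have f: "proj_simplex p F \<in> cyclic_simplices n m p" using one by (rule proj_simplex_in)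
  obtain j where j: "lift p (proj_simplex p F) = deck_simplex p j F"
    using lift_unique[OF one lift_in[OF f]] proj_lift[OF f] by metis
  show ?case
    using deck_translate_coboundary[OF one, of j] by (simp add: j)
next
  case (diff a b)
  from deck_coboundary_diff[OF diff] show ?case
    by (simp add: chain_map_diff lift_chain_diff algebra_simps)
qed (simp add: deck_coboundary_0)

lemma keys_deck:
  assumes "c \<in> step_chains m p" "F \<in> Poly_Mapping.keys c"
  shows "simplex_map p (\<lambda>z. z + int n) F \<in> Poly_Mapping.keys (deck p c)"
proof -
  let ?T = "simplex_map p (\<lambda>z. z + int n)"
  have F: "F \<in> step_simplices m p" using assms by (auto simp: step_chains_def)
  have inj: "?T F = ?T G \<longleftrightarrow> F = G" if G: "G \<in> step_simplices m p" for G
  proof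
    assume eq: "?T F = ?T G"
    show "F = G"
    proof
      fix x show "F x = G x"
        using fun_cong[OF eq, of x] F G
        by (cases "x \<in> standard_simplex p")
          (auto simp: simplex_map_def step_simplices_def extensional_def)
    qed
  qed simp
  have "Poly_Mapping.lookup (deck p c) (?T F) = Poly_Mapping.lookup c F"
    using assms(1) unfolding step_chains_def mem_Collect_eq
  proof (induction c rule: frag_induction)
    case (one G)
    show ?case using inj[OF one] by (simp add: lookup_single when_def)
  qed (simp_all add: chain_map_diff lookup_minus)
  then show ?thesis using assms(2) by (simp add: in_keys_iff)
qed

text \<open>Injectivity of \<open>1 - T\<close>: a simplex of a \<open>T\<close>-invariant chain whose value at a fixed vertex is
  maximal would be translated to one with a larger value.\<close>

lemma deck_fixed_imp_0:
  assumes c: "c \<in> step_chains m p" and fixed: "deck p c = c"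
  shows "c = 0"
proof (rule ccontr)
  assume "c \<noteq> 0"
  define v :: "nat \<Rightarrow> real" where "v = (\<lambda>j. if j = 0 then 1 else 0)"
  have v: "v \<in> standard_simplex p" by (simp add: v_def)
  let ?M = "Max ((\<lambda>F. F v) ` Poly_Mapping.keys c)"
  have "?M \<in> (\<lambda>F. F v) ` Poly_Mapping.keys c"
    using \<open>c \<noteq> 0\<close> by (intro Max_in) auto
  then obtain F where F: "?M = F v" "F \<in> Poly_Mapping.keys c"
    by (rule imageE)
  have "simplex_map p (\<lambda>z. z + int n) F \<in> Poly_Mapping.keys c"
    using keys_deck[OF c F(2)] fixed by simp
  then have "simplex_map p (\<lambda>z. z + int n) F v \<le> F v"
    unfolding F(1)[symmetric] by (intro Max_ge) auto
  then show False using v n_pos by (simp add: simplex_map_def)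
qed

section \<open>Homology of the cyclic closure spaces\<close>

lemma chain_boundary_deck: "chain_boundary (Suc p) (deck (Suc p) c) = deck p (chain_boundary (Suc p) c)"
  using chain_boundary_chain_map_gen[of "Suc p"] by simp

lemma chain_boundary_proj: "chain_boundary (Suc p) (proj (Suc p) c) = proj p (chain_boundary (Suc p) c)"
  using chain_boundary_chain_map_gen[of "Suc p"] by simp

definition boundaries :: "nat \<Rightarrow> int chain set" where
  "boundaries p = chain_boundary (Suc p) ` cyclic_chains (Suc p)"

lemma boundariesE:
  assumes "z \<in> boundaries p"
  obtains e where "e \<in> step_chains m (Suc p)" "z = proj p (chain_boundary (Suc p) e)"
proof -
  obtain d where d: "d \<in> cyclic_chains (Suc p)" "z = chain_boundary (Suc p) d"
    using assms by (auto simp: boundaries_def)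
  show ?thesis
    using that[OF lift_chain_in[OF d(1)]] d(2) proj_lift_chain[OF d(1)]
      chain_boundary_proj[of p "lift_chain (Suc p) d"] by simp
qed

lemma boundariesI:
  "e \<in> step_chains m (Suc p) \<Longrightarrow> proj p (chain_boundary (Suc p) e) \<in> boundaries p"
  unfolding boundaries_def chain_boundary_proj[symmetric] by (intro imageI proj_in)

lemma boundaries_subset: "boundaries p \<subseteq> {z \<in> cyclic_chains p. chain_boundary p z = 0}"
proof
  fix z assume "z \<in> boundaries p"
  then obtain e where e: "e \<in> step_chains m (Suc p)" "z = proj p (chain_boundary (Suc p) e)"
    by (rule boundariesE)
  then have "chain_boundary p z = 0"
    by (simp add: chain_boundary_chain_map_gen step_chains_boundary_boundary)
  then show "z \<in> {z \<in> cyclic_chains p. chain_boundary p z = 0}"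
    using e proj_in step_chains_boundary by simp
qed

text \<open>The boundary of the lift projects to \<open>\<partial>z = 0\<close>, so it lies in the kernel of the projection. The
  chain \<open>b\<close> represents the image of \<open>z\<close> under the connecting homomorphism.\<close>

lemma cycle_lift_boundary:
  assumes z: "z \<in> cyclic_chains (Suc p)" and cyc: "chain_boundary (Suc p) z = 0"
  obtains b where "b \<in> step_chains m p" "chain_boundary (Suc p) (lift_chain (Suc p) z) = b - deck p b"
proof -
  let ?d = "chain_boundary (Suc p) (lift_chain (Suc p) z)"
  have "?d - lift_chain p (proj p ?d) \<in> deck_coboundary p"
    by (intro lift_proj_coboundary step_chains_boundary lift_chain_in z)
  moreover have "proj p ?d = 0"
    using chain_boundary_proj[of p "lift_chain (Suc p) z"] proj_lift_chain[OF z] cyc by simp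
  ultimately show ?thesis
    using that by (auto simp: deck_coboundary_def)
qed

text \<open>If \<open>b = \<partial>e\<close>, then the lift of \<open>z\<close> minus \<open>(1 - T) e\<close> is a cycle on the line with the same
  projection \<open>z\<close>, and it bounds by acyclicity. To find \<open>e\<close>, it has to be seen that \<open>b\<close> is a
  cycle: \<open>(1 - T) \<partial>b = \<partial>\<partial>(lift z) = 0\<close> and \<open>1 - T\<close> is injective. Only in degree \<open>0\<close> does the
  augmentation of \<open>b\<close> remain as an obstruction.\<close>

lemma cycle_is_boundary:
  assumes z: "z \<in> cyclic_chains (Suc p)"
    and b: "b \<in> step_chains m p" "chain_boundary (Suc p) (lift_chain (Suc p) z) = b - deck p b"
    and zero: "p = 0 \<Longrightarrow> augmentation b = 0"
  shows "z \<in> boundaries (Suc p)"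
proof -
  have "if p = 0 then augmentation b = 0 else chain_boundary p b = 0"
  proof (cases p)
    case (Suc q)
    have "chain_boundary p (b - deck p b) = 0"
      using step_chains_boundary_boundary[OF lift_chain_in[OF z]] b(2) by simp
    then have "deck q (chain_boundary p b) = chain_boundary p b"
      using Suc by (simp add: chain_boundary_diff chain_boundary_deck)
    moreover have "chain_boundary p b \<in> step_chains m q"
      using b(1) Suc step_chains_boundary by simp
    ultimately show ?thesis using Suc deck_fixed_imp_0 by simp
  qed (use zero in simp)
  from step_cycle_imp_boundary[OF b(1) m_pos this]
  obtain e where e: "e \<in> step_chains m (Suc p)" "chain_boundary (Suc p) e = b"
    by blast
  define w where "w = lift_chain (Suc p) z - (e - deck (Suc p) e)"
  have w: "w \<in> step_chains m (Suc p)"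
    unfolding w_def using e(1)
    by (intro step_chains_diff deck_in lift_chain_in z) (simp_all add: step_chains_def)
  have "chain_boundary (Suc p) w = 0"
    by (simp add: w_def chain_boundary_diff chain_boundary_deck e b)
  then obtain h where h: "h \<in> step_chains m (Suc (Suc p))" "chain_boundary (Suc (Suc p)) h = w"
    using step_cycle_imp_boundary[OF w m_pos] by auto
  have "proj (Suc p) w = z"
    by (simp add: w_def chain_map_diff proj_deck proj_lift_chain[OF z])
  then show ?thesis
    using boundariesI[OF h(1)] h(2) by simp
qed

definition vertex_value :: "int chain \<Rightarrow> int" where
  "vertex_value = weighted_sum (\<lambda>\<sigma>. \<sigma> (\<lambda>j. if j = 0 then 1 else 0))"

text \<open>For a cycle this is \<open>n\<close> times its winding number around the circle: the total increase of the
  values along the lifted edges.\<close>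

definition winding :: "int chain \<Rightarrow> int" where
  "winding z = vertex_value (chain_boundary 1 (lift_chain 1 z))"

lemma vertex_value_deck: "vertex_value (b - deck 0 b) = - int n * augmentation b"
  using subset_UNIV[of "Poly_Mapping.keys b"]
proof (induction b rule: frag_induction)
  case (diff a b)
  have "a - b - deck 0 (a - b) = (a - deck 0 a) - (b - deck 0 b)"
    by (simp add: chain_map_diff)
  then show ?case
    using diff by (simp only: vertex_value_def weighted_sum_diff augmentation_def) (simp add: algebra_simps)
qed (simp_all add: vertex_value_def augmentation_def weighted_sum_diff simplex_map_def)

lemma winding_add: "winding (a + b) = winding a + winding b"
  by (simp add: winding_def lift_chain_add chain_boundary_add vertex_value_def weighted_sum_add)

lemma winding_cmul: "winding (frag_cmul k a) = k * winding a"
  by (simp add: winding_def lift_chain_cmul chain_boundary_cmul vertex_value_def weighted_sum_cmul)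

text \<open>The winding may be computed from any lift of the chain in place of the chosen one: changing the
  lift adds \<open>(1 - T) \<partial>a\<close> to its boundary, and \<open>\<partial>a\<close> has augmentation \<open>0\<close>.\<close>

lemma winding_proj:
  assumes c: "c \<in> step_chains m 1"
  shows "winding (proj 1 c) = vertex_value (chain_boundary 1 c)"
proof -
  obtain a where a: "c - lift_chain 1 (proj 1 c) = a - deck 1 a"
    using lift_proj_coboundary[OF c] by (auto simp: deck_coboundary_def)
  have "chain_boundary 1 (c - lift_chain 1 (proj 1 c)) =
      chain_boundary 1 a - deck 0 (chain_boundary 1 a)"
    unfolding a using chain_boundary_deck[of 0 a] by (simp add: chain_boundary_diff)
  then have "vertex_value (chain_boundary 1 (c - lift_chain 1 (proj 1 c))) = 0"
    using vertex_value_deck augmentation_boundary[of a] by simp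
  then show ?thesis
    by (simp add: winding_def chain_boundary_diff vertex_value_def weighted_sum_diff)
qed

text \<open>For \<open>\<partial>(lift z) = (1 - T) b\<close> the winding is \<open>- n\<close> times the augmentation of \<open>b\<close>, which is the
  obstruction to \<open>z\<close> being a boundary.\<close>

lemma winding_cycle:
  assumes z: "z \<in> cyclic_chains 1" and cyc: "chain_boundary 1 z = 0"
  shows "int n dvd winding z" "winding z = 0 \<longleftrightarrow> z \<in> boundaries 1"
proof -
  obtain b where b: "b \<in> step_chains m 0" "chain_boundary (Suc 0) (lift_chain (Suc 0) z) = b - deck 0 b"
    using cycle_lift_boundary[of z 0] z cyc by auto
  have w: "winding z = - int n * augmentation b"
    using vertex_value_deck[of b] b(2) by (simp add: winding_def)
  then show "int n dvd winding z" by simp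
  show "winding z = 0 \<longleftrightarrow> z \<in> boundaries 1"
  proof
    assume "winding z = 0"
    then have "augmentation b = 0" using w n_pos by simp
    then show "z \<in> boundaries 1"
      using cycle_is_boundary[of z 0 b] z b by simp
  next
    assume "z \<in> boundaries 1"
    then obtain e where e: "e \<in> step_chains m (Suc 1)" "z = proj 1 (chain_boundary (Suc 1) e)"
      by (rule boundariesE)
    then show "winding z = 0"
      using winding_proj[OF step_chains_boundary[OF e(1)]] step_chains_boundary_boundary[OF e(1)]
      by (simp add: vertex_value_def)
  qed
qed

text \<open>The edge that runs from \<open>0\<close> to \<open>n\<close> on the line at constant speed, rounded down, projects to a
  closed edge.\<close>

lemma exists_loop:
  obtains z where "z \<in> cyclic_chains 1" "chain_boundary 1 z = 0" "winding z = int n"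
proof -
  let ?S = "standard_simplex (Suc 0)"
  let ?f = "\<lambda>x::nat \<Rightarrow> real. \<lfloor>real n * x 1\<rfloor>"
  define F where "F = restrict ?f ?S"
  have "step_continuous_on m ?S ?f"
    unfolding step_continuous_on_def
  proof
    fix x :: "nat \<Rightarrow> real"
    have lim: "filterlim (\<lambda>y. real n * y 1) (nhds (real n * x 1)) (at x within ?S)"
      by (intro tendsto_intros tendsto_coordinate_within)
    have "\<forall>\<^sub>F y in at x within ?S. real n * x 1 - 1 < real n * y 1"
      "\<forall>\<^sub>F y in at x within ?S. real n * y 1 < real n * x 1 + 1"
      by (rule order_tendstoD[OF lim], simp)+
    then show "\<forall>\<^sub>F y in at x within ?S. \<bar>?f y - ?f x\<bar> \<le> int m"
    proof eventually_elim
      case (elim y)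
      then have "\<bar>?f y - ?f x\<bar> \<le> 1" by linarith
      then show ?case using m_pos by linarith
    qed
  qed
  then have "step_continuous_on m ?S F"
    by (rule step_continuous_on_cong[rotated]) (simp add: F_def)
  then have F: "F \<in> step_simplices m 1"
    by (simp add: step_simplices_def F_def)
  let ?c = "\<lambda>t::int. restrict (\<lambda>_. t) (standard_simplex 0)"
  have face0: "singular_face (Suc 0) 0 F = ?c (int n)"
  proof
    fix x :: "nat \<Rightarrow> real"
    show "singular_face (Suc 0) 0 F x = ?c (int n) x"
    proof (cases "x \<in> standard_simplex 0")
      case True
      then have "simplical_face 0 x \<in> ?S"
        using simplical_face_in_standard_simplex[of "Suc 0" 0 x] by simp
      moreover have "simplical_face 0 x (Suc 0) = 1"
        using True by (simp add: simplical_face_def standard_simplex_0)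
      ultimately show ?thesis
        using True by (simp add: singular_face_def F_def)
    qed (simp add: singular_face_def)
  qed
  have face1: "singular_face (Suc 0) (Suc 0) F = ?c 0"
  proof
    fix x :: "nat \<Rightarrow> real"
    show "singular_face (Suc 0) (Suc 0) F x = ?c 0 x"
    proof (cases "x \<in> standard_simplex 0")
      case True
      then have "simplical_face (Suc 0) x \<in> ?S"
        using simplical_face_in_standard_simplex[of "Suc 0" "Suc 0" x] by simp
      then show ?thesis
        using True by (simp add: singular_face_def F_def simplical_face_def)
    qed (simp add: singular_face_def)
  qed
  have bF: "chain_boundary 1 (frag_of F) = frag_of (?c (int n)) - frag_of (?c 0)"
    by (simp add: chain_boundary_of face0 face1 del: restrict_apply)
  have "simplex_map 0 (\<lambda>z. z mod int n) (?c (int n)) = simplex_map 0 (\<lambda>z. z mod int n) (?c 0)"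
    by (auto simp: simplex_map_def)
  then have "proj 0 (chain_boundary 1 (frag_of F)) = 0"
    by (simp only: bF chain_map_diff chain_map_of) simp
  then have "chain_boundary 1 (proj 1 (frag_of F)) = 0"
    using chain_boundary_proj[of 0 "frag_of F"] by simp
  moreover have "winding (proj 1 (frag_of F)) = int n"
    using winding_proj[of "frag_of F"] F bF
    by (simp add: vertex_value_def weighted_sum_diff)
  moreover have "proj 1 (frag_of F) \<in> cyclic_chains 1"
    using F by (intro proj_in) simp
  ultimately show ?thesis using that by blast
qed

lemma augmentation_0_iff_boundary:
  assumes z: "z \<in> cyclic_chains 0"
  shows "augmentation z = 0 \<longleftrightarrow> z \<in> boundaries 0"
proof
  assume "augmentation z = 0"
  then obtain e where "e \<in> step_chains m (Suc 0)" "chain_boundary (Suc 0) e = lift_chain 0 z"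
    using step_cycle_imp_boundary[OF lift_chain_in[OF z] m_pos] by (auto simp: augmentation_lift_chain)
  then show "z \<in> boundaries 0"
    using boundariesI[of e 0] proj_lift_chain[OF z] by simp
next
  assume "z \<in> boundaries 0"
  then show "augmentation z = 0"
    by (auto simp: boundaries_def augmentation_boundary)
qed

end

lemma free_Abelian_quotient_iso:
  assumes ZS: "Z \<subseteq> {c. Poly_Mapping.keys c \<subseteq> S}" and Z0: "0 \<in> Z"
    and Zdiff: "\<And>a b. a \<in> Z \<Longrightarrow> b \<in> Z \<Longrightarrow> a - b \<in> Z"
    and H: "group H"
    and h: "\<And>a b. a \<in> Z \<Longrightarrow> b \<in> Z \<Longrightarrow> h (a + b) = h a \<otimes>\<^bsub>H\<^esub> h b" "h ` Z = carrier H"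
    and ker: "\<And>z. z \<in> Z \<Longrightarrow> h z = \<one>\<^bsub>H\<^esub> \<longleftrightarrow> z \<in> B" and BZ: "B \<subseteq> Z"
  shows "group ((free_Abelian_group S)\<lparr>carrier := Z\<rparr> Mod B) \<and>
         (free_Abelian_group S)\<lparr>carrier := Z\<rparr> Mod B \<cong> H"
proof -
  let ?G = "(free_Abelian_group S)\<lparr>carrier := Z\<rparr>"
  have Zminus: "- a \<in> Z" if "a \<in> Z" for a
    using Zdiff[OF Z0 that] by simp
  have "subgroup Z (free_Abelian_group S)"
  proof (rule group.subgroupI[OF group_free_Abelian_group])
    show "inv\<^bsub>free_Abelian_group S\<^esub> a \<in> Z" if "a \<in> Z" for a
      using that Zminus ZS by (subst inv_free_Abelian_group) auto
    show "a \<otimes>\<^bsub>free_Abelian_group S\<^esub> b \<in> Z" if "a \<in> Z" "b \<in> Z" for a b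
      using Zdiff[OF that(1) Zminus[OF that(2)]] by simp
  qed (use ZS Z0 in \<open>auto simp: free_Abelian_group_def\<close>)
  then have G: "group ?G"
    by (rule group.subgroup_imp_group[OF group_free_Abelian_group])
  have "h \<in> hom ?G H"
    using h by (auto simp: hom_def)
  then interpret gh: group_hom ?G H h
    using G H by (simp add: group_hom_def group_hom_axioms_def)
  have "kernel ?G H h = B"
    using ker BZ by (auto simp: kernel_def)
  then show ?thesis
    using gh.FactGroup_iso gh.normal_kernel normal.factorgroup_is_group h(2) by force
qed

definition circle_homology :: "nat \<Rightarrow> int monoid" where
  "circle_homology k = (if k \<le> 1 then integer_group else singleton_group 0)"

context cyclic_cover
begin

text \<open>The isomorphism is induced by the augmentation in degree \<open>0\<close> and by the winding number in
  degree \<open>1\<close>. That the homology is a group is recorded because symmetry of isomorphism needs it.\<close>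

theorem homology_cyclic_closure_space:
  "group (closure_homology_group k (cyclic_set n) (cyclic_closure n m)) \<and>
   closure_homology_group k (cyclic_set n) (cyclic_closure n m) \<cong> circle_homology k"
proof -
  let ?Z = "{z \<in> cyclic_chains k. chain_boundary k z = 0}"
  have carrier: "carrier (closure_chain_group p (cyclic_set n) (cyclic_closure n m)) = cyclic_chains p" for p
    by (auto simp: closure_chain_group_def closure_singular_simplices_cyclic cyclic_chains_def)
  have hom_eq: "closure_homology_group k (cyclic_set n) (cyclic_closure n m) =
      (free_Abelian_group (cyclic_simplices n m k))\<lparr>carrier := ?Z\<rparr> Mod boundaries k"
    unfolding closure_homology_group_def closure_cycles_def closure_boundaries_def carrier
      boundaries_def
    by (simp add: closure_chain_group_def closure_singular_simplices_cyclic)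
  have Z0: "0 \<in> ?Z" by (simp add: cyclic_chains_def)
  consider "k = 0" | "k = 1" | p where "k = Suc (Suc p)"
    by (metis One_nat_def not0_implies_Suc)
  then obtain h where h:
    "\<And>a b. a \<in> ?Z \<Longrightarrow> b \<in> ?Z \<Longrightarrow> h (a + b) = h a \<otimes>\<^bsub>circle_homology k\<^esub> h b"
    "h ` ?Z = carrier (circle_homology k)"
    "\<And>z. z \<in> ?Z \<Longrightarrow> h z = \<one>\<^bsub>circle_homology k\<^esub> \<longleftrightarrow> z \<in> boundaries k"
  proof cases
    case 1
    have Z: "?Z = cyclic_chains 0" using 1 by (simp add: chain_boundary_def)
    have "restrict (\<lambda>_. 0) (standard_simplex 0) \<in> cyclic_simplices n m 0"
      using n_pos by (auto simp: cyclic_simplices_def cyclic_set_def cyclic_continuous_on_def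
          standard_simplex_0 eventually_at_filter intro!: exI[of _ 0])
    then have "j \<in> augmentation ` cyclic_chains 0" for j
      by (intro image_eqI[of _ _ "frag_cmul j (frag_of (restrict (\<lambda>_. 0) (standard_simplex 0)))"])
        (auto simp: augmentation_def weighted_sum_cmul cyclic_chains_def keys_frag_of)
    then have onto: "augmentation ` ?Z = carrier (circle_homology k)"
      using Z 1 by (auto simp: circle_homology_def integer_group_def)
    show ?thesis
    proof (rule that[of augmentation])
      show "augmentation z = \<one>\<^bsub>circle_homology k\<^esub> \<longleftrightarrow> z \<in> boundaries k" if "z \<in> ?Z" for z
        using augmentation_0_iff_boundary[of z] that 1
        by (simp add: circle_homology_def integer_group_def)
    qed (use 1 onto in \<open>simp_all add: circle_homology_def integer_group_def augmentation_def
        weighted_sum_add\<close>)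
  next
    case 2
    define h where "h z = winding z div int n" for z
    have dvd: "int n dvd winding z" and iff: "winding z = 0 \<longleftrightarrow> z \<in> boundaries 1" if "z \<in> ?Z" for z
      using winding_cycle[of z] that 2 by auto
    obtain l where l: "l \<in> cyclic_chains 1" "chain_boundary 1 l = 0" "winding l = int n"
      by (rule exists_loop)
    have "j \<in> h ` ?Z" for j
    proof (rule image_eqI[of _ _ "frag_cmul j l"])
      show "j = h (frag_cmul j l)"
        using l n_pos by (simp add: h_def winding_cmul)
      show "frag_cmul j l \<in> ?Z"
        using l 2 keys_cmul[of j l] by (auto simp: chain_boundary_cmul cyclic_chains_def)
    qed
    then have onto: "h ` ?Z = carrier (circle_homology k)"
      using 2 by (auto simp: circle_homology_def integer_group_def)
    show ?thesis
    proof (rule that[of h])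
      show "h (a + b) = h a \<otimes>\<^bsub>circle_homology k\<^esub> h b" if "a \<in> ?Z" "b \<in> ?Z" for a b
        using 2 div_add[OF dvd dvd, OF that]
        by (simp add: h_def winding_add circle_homology_def integer_group_def)
      show "h z = \<one>\<^bsub>circle_homology k\<^esub> \<longleftrightarrow> z \<in> boundaries k" if "z \<in> ?Z" for z
        using dvd[OF that] iff[OF that] 2 n_pos
        by (simp add: h_def dvd_div_eq_0_iff circle_homology_def integer_group_def)
    qed (rule onto)
  next
    case 3
    have "z \<in> boundaries k" if "z \<in> ?Z" for z
    proof -
      have z: "z \<in> cyclic_chains (Suc (Suc p))" "chain_boundary (Suc (Suc p)) z = 0"
        using that 3 by auto
      from cycle_lift_boundary[OF this] obtain b where "b \<in> step_chains m (Suc p)"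
        "chain_boundary (Suc (Suc p)) (lift_chain (Suc (Suc p)) z) = b - deck (Suc p) b" .
      from cycle_is_boundary[OF z(1) this] show ?thesis using 3 by simp
    qed
    then show ?thesis
      using 3 Z0 by (intro that[of "\<lambda>_. 0"]) (auto simp: circle_homology_def singleton_group_def)
  qed
  have H: "group (circle_homology k)"
    by (simp add: circle_homology_def)
  have sub: "?Z \<subseteq> {c. Poly_Mapping.keys c \<subseteq> cyclic_simplices n m k}"
    by (auto simp: cyclic_chains_def)
  have diff: "a - b \<in> ?Z" if "a \<in> ?Z" "b \<in> ?Z" for a b
    using that by (simp add: cyclic_chains_diff chain_boundary_diff)
  show ?thesis
    unfolding hom_eq
    by (rule free_Abelian_quotient_iso[OF sub Z0 diff H h boundaries_subset])
qed

end

theorem theorem5p19: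
  fixes m k :: nat
  assumes "m \<ge> 5"
  shows "closure_homology_group k (cyclic_set (4 * m - 4)) (cyclic_closure (4 * m - 4) m)
       \<cong> closure_homology_group k (cyclic_set (4 * m)) (cyclic_closure (4 * m) (m + 1))"
proof -
  have "cyclic_cover (4 * m - 4) m" "cyclic_cover (4 * m) (m + 1)"
    using assms by (simp_all add: cyclic_cover_def)
  from this[THEN cyclic_cover.homology_cyclic_closure_space, of k]
  have "closure_homology_group k (cyclic_set (4 * m - 4)) (cyclic_closure (4 * m - 4) m)
      \<cong> circle_homology k"
    and "circle_homology k
      \<cong> closure_homology_group k (cyclic_set (4 * m)) (cyclic_closure (4 * m) (m + 1))"
    by (blast intro: group.iso_sym)+
  then show ?thesis by (rule iso_trans)
qed

end
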